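(* Let $n\ge 3$ and $d\ge 0$ be integers, let $G\in\hat{\mathcal{K}}_{n,d}$, and let $k:=\max\{3,\omega(G)\}$, where $\omega(G)$ is the clique number of $G$. Then there exists $\epsilon>0$ such that $v(G,\epsilon)\in\mathrm{cone}(\mathrm{LS}_+^{n-k}(G))$, and $r_+(G)\ge n-k+1$.
   Context: Lift-and-project: for $P\subseteq[0,1]^n$, let $P_I=\mathrm{conv}(P\cap\{0,1\}^n)$ and $\mathrm{cone}(P)=\{(\lambda,\lambda x)\in\mathbb{R}^{n+1}:\lambda\ge 0,\ x\in P\}$, with coordinates indexed $0,1,\dots,n$. Let $e_i$ be the $i$-th unit vector and $\mathbb{S}^{n+1}_+$ the set of symmetric positive semidefinite $(n+1)\times(n+1)$ matrices. Define $\widehat{\mathrm{LS}}_+(P)=\{Y\in\mathbb{S}^{n+1}_+: Ye_0=\mathrm{diag}(Y),\ Ye_i\in\mathrm{cone}(P),\ Y(e_0-e_i)\in\mathrm{cone}(P)\ \forall i\in[n]\}$, $\mathrm{LS}_+(P)=\{x\in\mathbb{R}^n:\exists Y\in\widehat{\mathrm{LS}}_+(P),\ Ye_0=(1,x)\}$, $\mathrm{LS}_+^0(P)=P$ and $\mathrm{LS}_+^k(P)=\mathrm{LS}_+(\mathrm{LS}_+^{k-1}(P))$. For a graph $G$: $\mathrm{FRAC}(G)=\{x\in[0,1]^{V(G)}:x_i+x_j\le 1\ \forall \{i,j\}\in E(G)\}$, $\mathrm{STAB}(G)=\mathrm{FRAC}(G)_I$, $\mathrm{LS}_+^k(G):=\mathrm{LS}_+^k(\mathrm{FRAC}(G))$,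 and $r_+(G)$ is the least $k$ with $\mathrm{LS}_+^k(G)=\mathrm{STAB}(G)$. Stretched cliques: given a graph $G$, a vertex $v$ with neighborhood $\Gamma_G(v)$, and possibly empty sets $A_1,\dots,A_m\subseteq\Gamma_G(v)$ with $\bigcup_j A_j=\Gamma_G(v)$, stretching $v$ replaces $v$ by new vertices $v_0,v_1,\dots,v_m$ and joins, for each $j\in[m]$, $v_j$ to $v_0$ and to every vertex of $A_j$ (no other edges at the new vertices); for $m=2$ this is a 2-stretching. $K_n$ is the complete graph on $[n]$. For $n\ge 3,d\ge 0$, $\mathcal{K}_{n,d}$ is the set of graphs obtained from $K_n$ by 2-stretching $d$ of its $n$ original vertices (successively, each original vertex at most once). For $G\in\mathcal{K}_{n,d}$, $D(G)\subseteq[n]$ denotes the set of stretched vertices; for $i\in D(G)$, $i_0$ is called a hub vertex and $i_1,i_2$ wing vertices; vertices $i\in[n]\setminus D(G)$ are unstretched. The vertices associated with $i\in[n]$ are $i_0,i_1,i_2$ if $i\in D(G)$ and $i$ otherwise. $\hat{\mathcal{K}}_{n,d}$ is the set of $G\in\mathcal{K}_{n,d}$ such that for all distinct $i,j\in D(G)$, exactly one of $\{i_1,j_1\},\{i_1,j_2\},\{i_2,j_1\},\{i_2,j_2\}$ is an edge of $G$. For $G\in\mathcal{K}_{n,d}$ and $\epsilon>0$, let $D_0$ be the set of hub vertices of $G$ and define $v(G,\epsilon)=\sum_{S}\begin{bmatrix}1\\ \chi_S\end{bmatrix}-\epsilon\begin{bmatrix}1\\ \chi_{D_0}\end{bmatrix}\in\mathbb{R}^{\{0\}\cup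 V(G)}$, where the sum is over all stable sets $S$ of $G$ with $|S|=d+1$ and $\chi_S$ is the incidence vector. *)

theory Defs
  imports "HOL-Analysis.Analysis" "HOL-Library.Function_Algebras"
begin

text \<open>
  The dimension of the ambient space varies with the graph, so \<open>\<real>\<^sup>V\<close> is rendered as the set of
  functions that vanish outside the finite index set \<open>V\<close>.  The pointwise vector space structure on
  functions makes the library's \<open>convex hull\<close> available for them.
\<close>

instantiation "fun" :: (type, real_vector) real_vector
begin

definition scaleR_fun :: "real \<Rightarrow> ('a \<Rightarrow> 'b) \<Rightarrow> 'a \<Rightarrow> 'b" where
  "scaleR_fun c f = (\<lambda>x. c *\<^sub>R f x)"

instance
  by standard (simp_all add: scaleR_fun_def fun_eq_iff scaleR_add_right scaleR_add_left)

end

text \<open>\<open>S\<^sup>V\<close> for \<open>S \<subseteq> \<real>\<close>:\<close>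

definition fun_power :: "'a set \<Rightarrow> real set \<Rightarrow> ('a \<Rightarrow> real) set" where
  "fun_power V S = {x. (\<forall>v\<in>V. x v \<in> S) \<and> (\<forall>v. v \<notin> V \<longrightarrow> x v = 0)}"

definition integer_hull :: "'a set \<Rightarrow> ('a \<Rightarrow> real) set \<Rightarrow> ('a \<Rightarrow> real) set" where
  "integer_hull V P = convex hull (P \<inter> fun_power V {0, 1})"


section \<open>The lift-and-project operator\<close>

text \<open>The homogenizing coordinate \<open>0\<close> is \<open>None\<close>; the coordinate \<open>v \<in> V\<close> is \<open>Some v\<close>.\<close>

definition coords :: "'a set \<Rightarrow> 'a option set" where
  "coords V = insert None (Some ` V)"

definition lift_vec :: "real \<Rightarrow> ('a \<Rightarrow> real) \<Rightarrow> 'a option \<Rightarrow> real" where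
  "lift_vec a x = case_option a x"

definition lift_cone :: "('a \<Rightarrow> real) set \<Rightarrow> ('a option \<Rightarrow> real) set" where
  "lift_cone P = {lift_vec c (c *\<^sub>R x) | c x. c \<ge> 0 \<and> x \<in> P}"

definition unit_vec :: "'i \<Rightarrow> 'i \<Rightarrow> real" where
  "unit_vec i = (\<lambda>j. if j = i then 1 else 0)"

definition mat_vec :: "'i set \<Rightarrow> ('i \<Rightarrow> 'i \<Rightarrow> real) \<Rightarrow> ('i \<Rightarrow> real) \<Rightarrow> 'i \<Rightarrow> real" where
  "mat_vec I Y x = (\<lambda>r. \<Sum>s\<in>I. Y r s * x s)"

definition mat_diag :: "('i \<Rightarrow> 'i \<Rightarrow> real) \<Rightarrow> 'i \<Rightarrow> real" where
  "mat_diag Y = (\<lambda>r. Y r r)"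

definition sym_psd :: "'i set \<Rightarrow> ('i \<Rightarrow> 'i \<Rightarrow> real) set" where
  "sym_psd I = {Y. (\<forall>r s. r \<notin> I \<or> s \<notin> I \<longrightarrow> Y r s = 0) \<and>
                   (\<forall>r s. Y r s = Y s r) \<and>
                   (\<forall>x. (\<Sum>r\<in>I. x r * mat_vec I Y x r) \<ge> 0)}"

definition LS_plus_lifted ::
    "'a set \<Rightarrow> ('a \<Rightarrow> real) set \<Rightarrow> ('a option \<Rightarrow> 'a option \<Rightarrow> real) set" where
  "LS_plus_lifted V P = {Y \<in> sym_psd (coords V).
     mat_vec (coords V) Y (unit_vec None) = mat_diag Y \<and>
     (\<forall>i\<in>V. mat_vec (coords V) Y (unit_vec (Some i)) \<in> lift_cone P \<and>
            mat_vec (coords V) Y (unit_vec None - unit_vec (Some i)) \<in> lift_cone P)}"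

definition LS_plus :: "'a set \<Rightarrow> ('a \<Rightarrow> real) set \<Rightarrow> ('a \<Rightarrow> real) set" where
  "LS_plus V P =
     {x. \<exists>Y\<in>LS_plus_lifted V P. mat_vec (coords V) Y (unit_vec None) = lift_vec 1 x}"


section \<open>Graphs and the rank\<close>

datatype 'a graph = Graph (verts: "'a set") (edges: "'a set set")

definition neighborhood :: "'a graph \<Rightarrow> 'a \<Rightarrow> 'a set" where
  "neighborhood G v = {u \<in> verts G. {u, v} \<in> edges G}"

definition stable_set :: "'a graph \<Rightarrow> 'a set \<Rightarrow> bool" where
  "stable_set G S \<longleftrightarrow> S \<subseteq> verts G \<and> (\<forall>u\<in>S. \<forall>v\<in>S. {u, v} \<notin> edges G)"

definition clique :: "'a graph \<Rightarrow> 'a set \<Rightarrow> bool" where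
  "clique G C \<longleftrightarrow> C \<subseteq> verts G \<and> (\<forall>u\<in>C. \<forall>v\<in>C. u \<noteq> v \<longrightarrow> {u, v} \<in> edges G)"

definition clique_number :: "'a graph \<Rightarrow> nat" where
  "clique_number G = Max (card ` {C. clique G C})"

definition FRAC :: "'a graph \<Rightarrow> ('a \<Rightarrow> real) set" where
  "FRAC G = {x \<in> fun_power (verts G) {0..1}. \<forall>i j. {i, j} \<in> edges G \<longrightarrow> x i + x j \<le> 1}"

definition STAB :: "'a graph \<Rightarrow> ('a \<Rightarrow> real) set" where
  "STAB G = integer_hull (verts G) (FRAC G)"

definition LS_plus_graph :: "nat \<Rightarrow> 'a graph \<Rightarrow> ('a \<Rightarrow> real) set" where
  "LS_plus_graph k G = (LS_plus (verts G) ^^ k) (FRAC G)"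

definition LS_plus_rank :: "'a graph \<Rightarrow> nat" where
  "LS_plus_rank G = (LEAST k. LS_plus_graph k G = STAB G)"


section \<open>Stretched cliques\<close>

text \<open>\<open>Sub v j\<close> is the vertex \<open>v\<^sub>j\<close> created by stretching \<open>v\<close>.\<close>

datatype vertex = Orig nat | Sub vertex nat

text \<open>The list \<open>As\<close> holds \<open>A\<^sub>1, \<dots>, A\<^sub>m\<close>, with \<open>A\<^sub>j\<close> at list position \<open>j - 1\<close>.\<close>

definition stretch :: "vertex graph \<Rightarrow> vertex \<Rightarrow> vertex set list \<Rightarrow> vertex graph" where
  "stretch G v As = Graph
     ((verts G - {v}) \<union> {Sub v j | j. j \<le> length As})
     ({e \<in> edges G. v \<notin> e} \<union>
      {{Sub v j, Sub v 0} | j. j \<in> {1..length As}} \<union>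
      {{Sub v j, u} | j u. j \<in> {1..length As} \<and> u \<in> As ! (j - 1)})"

definition complete_graph :: "nat \<Rightarrow> vertex graph" where
  "complete_graph n = Graph (Orig ` {1..n})
     {{Orig i, Orig j} | i j. i \<in> {1..n} \<and> j \<in> {1..n} \<and> i \<noteq> j}"

text \<open>
  Stretching \<open>Orig i\<close> removes it from the vertex set, so each original vertex is stretched at most
  once.
\<close>

inductive stretched_clique :: "nat \<Rightarrow> nat \<Rightarrow> vertex graph \<Rightarrow> bool" for n :: nat where
  base: "stretched_clique n 0 (complete_graph n)"
| step: "stretched_clique n (Suc d) (stretch G (Orig i) [A\<^sub>1, A\<^sub>2])"
    if "stretched_clique n d G" and "i \<in> {1..n}" and "Orig i \<in> verts G"
      and "A\<^sub>1 \<union> A\<^sub>2 = neighborhood G (Orig i)"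

definition stretched_verts :: "vertex graph \<Rightarrow> nat set" where
  "stretched_verts G = {i. Sub (Orig i) 0 \<in> verts G}"

definition hubs :: "vertex graph \<Rightarrow> vertex set" where
  "hubs G = (\<lambda>i. Sub (Orig i) 0) ` stretched_verts G"

definition stretched_clique_hat :: "nat \<Rightarrow> nat \<Rightarrow> vertex graph \<Rightarrow> bool" where
  "stretched_clique_hat n d G \<longleftrightarrow> stretched_clique n d G \<and>
     (\<forall>i\<in>stretched_verts G. \<forall>j\<in>stretched_verts G. i \<noteq> j \<longrightarrow>
       (\<exists>!p. p \<in> {1, 2} \<times> {1, 2} \<and>
             {Sub (Orig i) (fst p), Sub (Orig j) (snd p)} \<in> edges G))"

definition v_vec :: "nat \<Rightarrow> vertex graph \<Rightarrow> real \<Rightarrow> vertex option \<Rightarrow> real" where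
  "v_vec d G \<epsilon> = (\<Sum>S | stable_set G S \<and> card S = d + 1. lift_vec 1 (indicat_real S))
                 - \<epsilon> *\<^sub>R lift_vec 1 (indicat_real (hubs G))"

end

theory Submission
  imports Defs
begin

text \<open>
  The membership is proved by induction on the number \<open>m\<close> of rounds.  Write \<open>[S]\<close> for the vector
  \<open>(1, \<chi>\<^sub>S)\<close>, \<open>b\<close> for \<open>[D\<^sub>0]\<close>, \<open>e\<^sub>v\<close> for unit vectors, and let \<open>S\<^sub>j\<close> be the stable set obtained from \<open>D\<^sub>0\<close> by
  adding the unstretched vertex \<open>j\<close>, or by exchanging the hub of \<open>j\<close> for its two wings.  If \<open>G\<close> has no
  clique of size \<open>n\<close>, some stretched \<open>i\<close> has wings \<open>i\<^sub>1, i\<^sub>2\<close> that see no vertex of an index \<open>u\<close> and of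
  an index \<open>w\<close>, respectively.  With \<open>f\<^sub>j = [S\<^sub>j] - b\<close> the certificate is
  \<open>\<Sum>\<^sub>S [S][S]\<^sup>T - \<eta> b b\<^sup>T + \<eta> E\<close>, where \<open>E\<close> is the symmetrization of the five-cycle
  \<open>e(i\<^sub>0) f\<^sub>u - f\<^sub>u e(i\<^sub>1) + e(i\<^sub>1) e(i\<^sub>2) - e(i\<^sub>2) f\<^sub>w + f\<^sub>w e(i\<^sub>0)\<close>.  The term \<open>E\<close> restores positive
  semidefiniteness on the kernel of the first sum, and each column is a vector \<open>v(H, \<epsilon>')\<close> for a graph
  \<open>H\<close> with one index fewer plus a nonnegative combination of stable sets.

  For the rank, stable sets have at most \<open>d + 1\<close> vertices, which \<open>v(G, \<epsilon>)\<close> violates; since \<open>LEAST\<close> is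
  unspecified on an empty predicate, one also needs that the hierarchy reaches \<open>STAB\<close>.
\<close>

section \<open>The lifted cone and the operator\<close>

lemma scaleR_fun_apply [simp]: "(c *\<^sub>R f) x = c *\<^sub>R f x"
  by (simp add: scaleR_fun_def)

lemma sum_fun_apply: "(\<Sum>a\<in>A. f a) x = (\<Sum>a\<in>A. f a x)"
  for f :: "'a \<Rightarrow> 'b \<Rightarrow> real"
  by (induction A rule: infinite_finite_induct) auto

lemma lift_vec_simps [simp]: "lift_vec a x None = a" "lift_vec a x (Some v) = x v"
  by (simp_all add: lift_vec_def)

lemma lift_vec_eqI:
  assumes "y None = a" "\<And>v. y (Some v) = x v"
  shows "y = lift_vec a x"
proof
  fix r show "y r = lift_vec a x r" using assms by (cases r) auto
qed

lemma lift_coneI: "0 \<le> c \<Longrightarrow> x \<in> P \<Longrightarrow> lift_vec c (c *\<^sub>R x) \<in> lift_cone P"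
  unfolding lift_cone_def by blast

lemma lift_coneE:
  assumes "y \<in> lift_cone P"
  obtains c x where "0 \<le> c" "x \<in> P" "y = lift_vec c (c *\<^sub>R x)"
  using assms unfolding lift_cone_def by blast

lemma lift_cone_mono: "P \<subseteq> Q \<Longrightarrow> lift_cone P \<subseteq> lift_cone Q"
  unfolding lift_cone_def by blast

lemma zero_in_lift_cone: "P \<noteq> {} \<Longrightarrow> 0 \<in> lift_cone P"
proof -
  assume "P \<noteq> {}"
  then obtain x where "x \<in> P" by blast
  moreover have "0 = lift_vec 0 (0 *\<^sub>R x)" by (rule lift_vec_eqI) auto
  ultimately show ?thesis by (metis lift_coneI order_refl)
qed

lemma lift_cone_scaleR:
  assumes "y \<in> lift_cone P" "0 \<le> t"
  shows "t *\<^sub>R y \<in> lift_cone P"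
proof -
  obtain c x where y: "0 \<le> c" "x \<in> P" "y = lift_vec c (c *\<^sub>R x)"
    using assms(1) by (rule lift_coneE)
  have "t *\<^sub>R y = lift_vec (t * c) ((t * c) *\<^sub>R x)"
    by (rule lift_vec_eqI) (simp_all add: y)
  then show ?thesis using y assms(2) by (simp add: lift_coneI)
qed

lemma lift_cone_add:
  assumes "convex P" "y \<in> lift_cone P" "z \<in> lift_cone P"
  shows "y + z \<in> lift_cone P"
proof -
  obtain c x where y: "0 \<le> c" "x \<in> P" "y = lift_vec c (c *\<^sub>R x)"
    using assms(2) by (rule lift_coneE)
  obtain c' x' where z: "0 \<le> c'" "x' \<in> P" "z = lift_vec c' (c' *\<^sub>R x')"
    using assms(3) by (rule lift_coneE)
  show ?thesis
  proof (cases "c + c' = 0")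
    case True
    then have "c = 0" "c' = 0" using y(1) z(1) by auto
    then have "y + z = lift_vec 0 (0 *\<^sub>R x)"
      using y z by (intro lift_vec_eqI) auto
    then show ?thesis using y(2) by (metis lift_coneI order_refl)
  next
    case False
    define s where "s = c + c'"
    have s: "s > 0" using False y(1) z(1) by (auto simp: s_def)
    have "c / s + c' / s = 1" using s by (simp add: s_def flip: add_divide_distrib)
    then have "(c / s) *\<^sub>R x + (c' / s) *\<^sub>R x' \<in> P"
      using assms(1) y z s by (intro convexD) auto
    moreover have "y + z = lift_vec s (s *\<^sub>R ((c / s) *\<^sub>R x + (c' / s) *\<^sub>R x'))"
    proof (rule lift_vec_eqI)
      fix v
      have "c * x v = s * ((c / s) * x v)" "c' * x' v = s * ((c' / s) * x' v)" using s by simp_all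
      then show "(y + z) (Some v) = (s *\<^sub>R ((c / s) *\<^sub>R x + (c' / s) *\<^sub>R x')) v"
        by (simp add: y z distrib_left)
    qed (simp add: y z s_def)
    ultimately show ?thesis using s by (simp add: lift_coneI)
  qed
qed

lemma lift_cone_sum:
  assumes "convex P" "P \<noteq> {}" "\<And>a. a \<in> A \<Longrightarrow> f a \<in> lift_cone P"
  shows "(\<Sum>a\<in>A. f a) \<in> lift_cone P"
  using assms(3)
proof (induction A rule: infinite_finite_induct)
  case (insert a A)
  then show ?case by (simp add: lift_cone_add[OF assms(1)] del: plus_fun_apply)
qed (simp_all add: zero_in_lift_cone[OF assms(2)])

lemma lift_vec_one_in_lift_cone_iff [simp]: "lift_vec 1 x \<in> lift_cone P \<longleftrightarrow> x \<in> P"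
proof
  assume "lift_vec 1 x \<in> lift_cone P"
  then obtain c y where y: "0 \<le> c" "y \<in> P" and eq: "lift_vec 1 x = lift_vec c (c *\<^sub>R y)"
    by (rule lift_coneE)
  have "c = 1" using fun_cong[OF eq, of None] by simp
  moreover have "x v = y v" for v using fun_cong[OF eq, of "Some v"] \<open>c = 1\<close> by simp
  ultimately show "x \<in> P" using y by (metis ext)
next
  assume "x \<in> P"
  then show "lift_vec 1 x \<in> lift_cone P" using lift_coneI[of 1 x P] by simp
qed

lemma finite_coords [simp]: "finite V \<Longrightarrow> finite (coords V)"
  by (simp add: coords_def)

lemma in_coords [simp]: "None \<in> coords V" "Some v \<in> coords V \<longleftrightarrow> v \<in> V"
  by (auto simp: coords_def)

section \<open>One application of the operator, read off the columns of the matrix\<close>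

lemma mat_vec_unit_vec:
  assumes "finite I" "i \<in> I"
  shows "mat_vec I Y (unit_vec i) = (\<lambda>r. Y r i)"
  using assms by (auto simp: mat_vec_def unit_vec_def if_distrib cong: if_cong)

lemma mat_vec_diff: "mat_vec I Y (x - y) = mat_vec I Y x - mat_vec I Y y"
  by (auto simp: mat_vec_def algebra_simps sum_subtractf)

lemma sym_psd_iff:
  "Y \<in> sym_psd I \<longleftrightarrow> (\<forall>r s. r \<notin> I \<or> s \<notin> I \<longrightarrow> Y r s = 0) \<and> (\<forall>r s. Y r s = Y s r) \<and>
     (\<forall>x. (\<Sum>r\<in>I. \<Sum>s\<in>I. x r * x s * Y r s) \<ge> 0)"
  by (simp add: sym_psd_def mat_vec_def sum_distrib_left ac_simps)

text \<open>Multiplying by a unit vector selects a column, so membership becomes a condition on the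
  columns of \<open>Y\<close> and on their differences to column \<open>None\<close>. All later
  arguments use the operator in this form.\<close>

lemma LS_plus_iff:
  assumes "finite V"
  shows "x \<in> LS_plus V P \<longleftrightarrow> (\<exists>Y\<in>sym_psd (coords V). (\<forall>r. Y r None = Y r r) \<and>
      (\<forall>i\<in>V. (\<lambda>r. Y r (Some i)) \<in> lift_cone P \<and> (\<lambda>r. Y r None - Y r (Some i)) \<in> lift_cone P) \<and>
      (\<lambda>r. Y r None) = lift_vec 1 x)"
proof -
  have col0: "mat_vec (coords V) Y (unit_vec None) = (\<lambda>r. Y r None)" for Y
    using assms by (intro mat_vec_unit_vec) auto
  have col: "mat_vec (coords V) Y (unit_vec (Some i)) = (\<lambda>r. Y r (Some i))" if "i \<in> V" for Y i
    using assms that by (intro mat_vec_unit_vec) auto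
  have diff: "mat_vec (coords V) Y (unit_vec None - unit_vec (Some i)) = (\<lambda>r. Y r None - Y r (Some i))"
    if "i \<in> V" for Y i
    unfolding mat_vec_diff col0 col[OF that] by (simp add: fun_diff_def)
  have diag: "(\<lambda>r. Y r None) = mat_diag Y \<longleftrightarrow> (\<forall>r. Y r None = Y r r)" for Y
    by (auto simp: mat_diag_def fun_eq_iff)
  have "Y \<in> LS_plus_lifted V P \<longleftrightarrow> Y \<in> sym_psd (coords V) \<and> (\<forall>r. Y r None = Y r r) \<and>
      (\<forall>i\<in>V. (\<lambda>r. Y r (Some i)) \<in> lift_cone P \<and> (\<lambda>r. Y r None - Y r (Some i)) \<in> lift_cone P)" for Y
    unfolding LS_plus_lifted_def mem_Collect_eq col0 diag
    by (intro conj_cong refl ball_cong) (simp_all only: col diff)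
  then show ?thesis unfolding LS_plus_def mem_Collect_eq col0 by blast
qed

lemma sym_psd_scaleR:
  assumes "Y \<in> sym_psd I" "0 \<le> t"
  shows "(\<lambda>r s. t * Y r s) \<in> sym_psd I"
proof -
  have "(\<Sum>r\<in>I. \<Sum>s\<in>I. x r * x s * (t * Y r s)) = t * (\<Sum>r\<in>I. \<Sum>s\<in>I. x r * x s * Y r s)" for x
    by (simp add: sum_distrib_left ac_simps)
  then show ?thesis using assms unfolding sym_psd_iff by simp
qed

lemma sym_psd_add:
  assumes "Y \<in> sym_psd I" "Z \<in> sym_psd I"
  shows "(\<lambda>r s. Y r s + Z r s) \<in> sym_psd I"
proof -
  have "(\<Sum>r\<in>I. \<Sum>s\<in>I. x r * x s * (Y r s + Z r s)) =
     (\<Sum>r\<in>I. \<Sum>s\<in>I. x r * x s * Y r s) + (\<Sum>r\<in>I. \<Sum>s\<in>I. x r * x s * Z r s)" for x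
    by (simp add: distrib_left sum.distrib)
  moreover have "\<forall>r s. Y r s + Z r s = Y s r + Z s r" using assms unfolding sym_psd_iff by metis
  ultimately show ?thesis using assms unfolding sym_psd_iff by simp
qed

text \<open>Dividing by \<open>Y None None\<close> normalizes the matrix. This admits certificates
  whose corner entry is any positive number instead of 1.\<close>

lemma lift_cone_LS_plusI:
  assumes V: "finite V" and psd: "Y \<in> sym_psd (coords V)" and diag: "\<And>r. Y r None = Y r r"
    and cols: "\<And>i. i \<in> V \<Longrightarrow> (\<lambda>r. Y r (Some i)) \<in> lift_cone P"
      "\<And>i. i \<in> V \<Longrightarrow> (\<lambda>r. Y r None - Y r (Some i)) \<in> lift_cone P"
    and pos: "Y None None > 0"
  shows "(\<lambda>r. Y r None) \<in> lift_cone (LS_plus V P)"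
proof -
  define c where "c = Y None None"
  define x where "x = (\<lambda>v. Y (Some v) None / c)"
  define Z where "Z = (\<lambda>r s. (1 / c) * Y r s)"
  have c: "c > 0" using pos by (simp add: c_def)
  have "Z \<in> sym_psd (coords V)" unfolding Z_def using psd c by (intro sym_psd_scaleR) auto
  moreover have "Z r None = Z r r" for r using diag by (simp add: Z_def)
  moreover have "(\<lambda>r. Z r (Some i)) \<in> lift_cone P" if "i \<in> V" for i
    using lift_cone_scaleR[OF cols(1)[OF that], of "1 / c"] c by (simp add: Z_def scaleR_fun_def)
  moreover have "(\<lambda>r. Z r None - Z r (Some i)) \<in> lift_cone P" if "i \<in> V" for i
    using lift_cone_scaleR[OF cols(2)[OF that], of "1 / c"] c
    by (simp add: Z_def scaleR_fun_def diff_divide_distrib)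
  moreover have "(\<lambda>r. Z r None) = lift_vec 1 x"
    using c by (intro lift_vec_eqI) (simp_all add: Z_def c_def x_def)
  ultimately have "x \<in> LS_plus V P" unfolding LS_plus_iff[OF V] by blast
  moreover have "(\<lambda>r. Y r None) = lift_vec c (c *\<^sub>R x)"
    using c by (intro lift_vec_eqI) (simp_all add: c_def x_def)
  ultimately show ?thesis using c by (simp add: lift_coneI)
qed

lemma convex_LS_plus:
  assumes V: "finite V" and P: "convex P"
  shows "convex (LS_plus V P)"
proof (rule convexI)
  fix x y :: "'a \<Rightarrow> real" and a b :: real
  assume x: "x \<in> LS_plus V P" and y: "y \<in> LS_plus V P" and ab: "0 \<le> a" "0 \<le> b" "a + b = 1"
  obtain X where X: "X \<in> sym_psd (coords V)" "\<And>r. X r None = X r r"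
      "\<And>i. i \<in> V \<Longrightarrow> (\<lambda>r. X r (Some i)) \<in> lift_cone P"
      "\<And>i. i \<in> V \<Longrightarrow> (\<lambda>r. X r None - X r (Some i)) \<in> lift_cone P"
      "(\<lambda>r. X r None) = lift_vec 1 x"
    using x unfolding LS_plus_iff[OF V] by blast
  obtain Y where Y: "Y \<in> sym_psd (coords V)" "\<And>r. Y r None = Y r r"
      "\<And>i. i \<in> V \<Longrightarrow> (\<lambda>r. Y r (Some i)) \<in> lift_cone P"
      "\<And>i. i \<in> V \<Longrightarrow> (\<lambda>r. Y r None - Y r (Some i)) \<in> lift_cone P"
      "(\<lambda>r. Y r None) = lift_vec 1 y"
    using y unfolding LS_plus_iff[OF V] by blast
  define Z where "Z = (\<lambda>r s. a * X r s + b * Y r s)"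
  have "Z \<in> sym_psd (coords V)"
    unfolding Z_def using X(1) Y(1) ab by (intro sym_psd_add sym_psd_scaleR) auto
  moreover have "Z r None = Z r r" for r using X(2) Y(2) by (simp add: Z_def)
  moreover have "(\<lambda>r. Z r (Some i)) \<in> lift_cone P" if "i \<in> V" for i
    using lift_cone_add[OF P lift_cone_scaleR[OF X(3)[OF that] ab(1)]
        lift_cone_scaleR[OF Y(3)[OF that] ab(2)]]
    by (simp add: Z_def scaleR_fun_def plus_fun_def)
  moreover have "(\<lambda>r. Z r None - Z r (Some i)) \<in> lift_cone P" if "i \<in> V" for i
    using lift_cone_add[OF P lift_cone_scaleR[OF X(4)[OF that] ab(1)]
        lift_cone_scaleR[OF Y(4)[OF that] ab(2)]]
    by (simp add: Z_def scaleR_fun_def plus_fun_def algebra_simps)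
  moreover have "(\<lambda>r. Z r None) = lift_vec 1 (a *\<^sub>R x + b *\<^sub>R y)"
    using fun_cong[OF X(5)] fun_cong[OF Y(5)] ab by (intro lift_vec_eqI) (simp_all add: Z_def)
  ultimately show "a *\<^sub>R x + b *\<^sub>R y \<in> LS_plus V P" unfolding LS_plus_iff[OF V] by blast
qed

text \<open>Column \<open>None\<close> is the sum of column \<open>i\<close> and its complement,
  both in the cone; an index \<open>i\<close> for this comes from
  \<open>V \<noteq> {}\<close>.\<close>

lemma LS_plus_subset:
  assumes "finite V" "V \<noteq> {}" "convex P"
  shows "LS_plus V P \<subseteq> P"
proof
  fix x assume "x \<in> LS_plus V P"
  then obtain Y where Y: "\<And>i. i \<in> V \<Longrightarrow> (\<lambda>r. Y r (Some i)) \<in> lift_cone P"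
      "\<And>i. i \<in> V \<Longrightarrow> (\<lambda>r. Y r None - Y r (Some i)) \<in> lift_cone P"
      "(\<lambda>r. Y r None) = lift_vec 1 x"
    unfolding LS_plus_iff[OF assms(1)] by blast
  obtain i where "i \<in> V" using assms(2) by blast
  then have "(\<lambda>r. Y r None) \<in> lift_cone P"
    using lift_cone_add[OF assms(3) Y(1)[of i] Y(2)[of i]] by (simp add: plus_fun_def)
  then show "x \<in> P" using Y(3) by simp
qed

text \<open>The rank-one matrix of a 0/1 vector is a certificate: each column and each complement is
  either 0 or the vector itself.\<close>

lemma LS_plus_indicator:
  assumes V: "finite V" and S: "S \<subseteq> V" "indicat_real S \<in> P"
  shows "indicat_real S \<in> LS_plus V P"
proof -
  define y where "y = lift_vec 1 (indicat_real S)"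
  have y: "y \<in> lift_cone P" "0 \<in> lift_cone P"
    using S(2) by (auto simp: y_def intro!: zero_in_lift_cone)
  have y01: "y r = 0 \<or> y r = 1" for r by (cases r) (auto simp: y_def indicator_def)
  have "(\<lambda>r s. y r * y s) \<in> sym_psd (coords V)"
    unfolding sym_psd_iff
  proof (intro conjI allI impI)
    fix r s assume "r \<notin> coords V \<or> s \<notin> coords V"
    then show "y r * y s = 0"
      using S(1) by (cases r; cases s) (auto simp: y_def indicator_def)
  next
    fix x :: "'a option \<Rightarrow> real"
    have "(\<Sum>r\<in>coords V. \<Sum>s\<in>coords V. x r * x s * (y r * y s)) = (\<Sum>r\<in>coords V. x r * y r)\<^sup>2"
      by (simp add: power2_eq_square sum_product ac_simps)
    then show "(\<Sum>r\<in>coords V. \<Sum>s\<in>coords V. x r * x s * (y r * y s)) \<ge> 0" by simp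
  qed (simp add: mult.commute)
  moreover have "y r * y None = y r * y r" for r using y01[of r] by (auto simp: y_def)
  moreover have "(\<lambda>r. y r * y (Some i)) \<in> lift_cone P \<and> (\<lambda>r. y r * y None - y r * y (Some i)) \<in> lift_cone P" for i
    using y y01[of "Some i"] by (auto simp: zero_fun_def) (auto simp: y_def)
  moreover have "(\<lambda>r. y r * y None) = lift_vec 1 (indicat_real S)"
    by (intro lift_vec_eqI) (simp_all add: y_def)
  ultimately show ?thesis unfolding LS_plus_iff[OF V]
    by (intro bexI[where x = "\<lambda>r s. y r * y s"]) blast+
qed

section \<open>The fractional stable set polytope and its iterates\<close>

lemma convex_FRAC: "convex (FRAC G)"
proof (rule convexI)
  fix x y :: "'a \<Rightarrow> real" and a b :: real
  assume xy: "x \<in> FRAC G" "y \<in> FRAC G" and ab: "0 \<le> a" "0 \<le> b" "a + b = 1"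
  have "a * x v + b * y v \<in> {0..1}" if "v \<in> verts G" for v
  proof -
    have "x v \<in> {0..1}" "y v \<in> {0..1}" using xy that by (auto simp: FRAC_def fun_power_def)
    then show ?thesis using ab convex_bound_le[of "x v" 1 "y v" a b] by simp
  qed
  moreover have "a * x i + b * y i + (a * x j + b * y j) \<le> 1" if "{i, j} \<in> edges G" for i j
  proof -
    have "x i + x j \<le> 1" "y i + y j \<le> 1" using xy that by (auto simp: FRAC_def)
    then show ?thesis
      using ab convex_bound_le[of "x i + x j" 1 "y i + y j" a b] by (simp add: algebra_simps)
  qed
  ultimately show "a *\<^sub>R x + b *\<^sub>R y \<in> FRAC G"
    using xy by (auto simp: FRAC_def fun_power_def)
qed

lemma LS_plus_graph_0 [simp]: "LS_plus_graph 0 G = FRAC G"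
  by (simp add: LS_plus_graph_def)

lemma LS_plus_graph_Suc [simp]:
  "LS_plus_graph (Suc m) G = LS_plus (verts G) (LS_plus_graph m G)"
  by (simp add: LS_plus_graph_def)

lemma convex_LS_plus_graph: "finite (verts G) \<Longrightarrow> convex (LS_plus_graph m G)"
  by (induction m) (auto simp: convex_FRAC convex_LS_plus)

lemma LS_plus_graph_antimono:
  assumes "finite (verts G)" "verts G \<noteq> {}" "m \<le> m'"
  shows "LS_plus_graph m' G \<subseteq> LS_plus_graph m G"
  using assms(3)
proof (induction rule: dec_induct)
  case (step l)
  then show ?case using LS_plus_subset[OF assms(1,2) convex_LS_plus_graph[OF assms(1), of l]] by auto
qed simp

lemma indicator_in_FRAC:
  assumes "stable_set G S"
  shows "indicat_real S \<in> FRAC G"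
proof -
  have "indicat_real S i + indicat_real S j \<le> 1" if "{i, j} \<in> edges G" for i j
  proof -
    have "\<not> (i \<in> S \<and> j \<in> S)" using assms that unfolding stable_set_def by blast
    then show ?thesis by (auto simp: indicator_def)
  qed
  moreover have "indicat_real S v = 0" if "v \<notin> verts G" for v
    using assms that unfolding stable_set_def by (auto simp: indicator_def)
  moreover have "indicat_real S v \<in> {0..1}" for v by (simp add: indicator_def)
  ultimately show ?thesis by (simp add: FRAC_def fun_power_def)
qed

lemma stable_indicator_in_LS_plus_graph:
  assumes "finite (verts G)" "stable_set G S"
  shows "indicat_real S \<in> LS_plus_graph m G"
proof (induction m)
  case (Suc m)
  then show ?case using assms by (auto simp: stable_set_def intro!: LS_plus_indicator)
qed (simp add: indicator_in_FRAC assms)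

section \<open>Extending points of an induced subgraph by coordinates fixed to 1\<close>

definition induced :: "'a graph \<Rightarrow> 'a set \<Rightarrow> 'a graph" where
  "induced G W = Graph (verts G \<inter> W) {e \<in> edges G. e \<subseteq> W}"

lemma verts_induced [simp]: "verts (induced G W) = verts G \<inter> W"
  and edges_induced [simp]: "edges (induced G W) = {e \<in> edges G. e \<subseteq> W}"
  by (simp_all add: induced_def)

text \<open>Homogenized form of setting the coordinates in \<open>Z\<close> to 1: they receive
  \<open>y None\<close> instead, which keeps the map linear.\<close>

definition add_fixed :: "'a set \<Rightarrow> ('a option \<Rightarrow> real) \<Rightarrow> 'a option \<Rightarrow> real" where
  "add_fixed Z y = lift_vec (y None) (\<lambda>v. if v \<in> Z then y None else y (Some v))"

text \<open>Identifying the coordinates in \<open>Z\<close> with \<open>None\<close> turns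
  \<open>add_fixed\<close> into composition with an index map, which can then act on the rows and
  columns of a matrix alike.\<close>

definition fix_coord :: "'a set \<Rightarrow> 'a option \<Rightarrow> 'a option" where
  "fix_coord Z r = (case r of None \<Rightarrow> None | Some v \<Rightarrow> if v \<in> Z then None else Some v)"

lemma add_fixed_eq: "add_fixed Z y = (\<lambda>r. y (fix_coord Z r))"
  by (auto simp: add_fixed_def fix_coord_def lift_vec_def split: option.splits)

text \<open>A quadratic form pulled back along \<open>h\<close> is the original form at the vector
  of fibre sums, hence again nonnegative. Indices that \<open>h\<close> maps outside
  \<open>I\<close> meet zero entries only.\<close>

lemma sym_psd_reindex:
  assumes "finite I" "finite J" "Y \<in> sym_psd I" "\<And>r. r \<notin> J \<Longrightarrow> h r \<notin> I"
  shows "(\<lambda>r s. Y (h r) (h s)) \<in> sym_psd J"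
  unfolding sym_psd_iff
proof (intro conjI allI impI)
  fix r s assume "r \<notin> J \<or> s \<notin> J"
  then show "Y (h r) (h s) = 0" using assms unfolding sym_psd_iff by blast
next
  fix r s show "Y (h r) (h s) = Y (h s) (h r)" using assms unfolding sym_psd_iff by blast
next
  fix x :: "'b \<Rightarrow> real"
  define y where "y = (\<lambda>a. \<Sum>r | r \<in> J \<and> h r = a. x r)"
  have out: "Y a b = 0" if "a \<notin> I \<or> b \<notin> I" for a b
    using assms(3) that unfolding sym_psd_iff by blast
  have collapse: "(\<Sum>r\<in>J. x r * F (h r)) = (\<Sum>a\<in>I. y a * F a)"
    if F: "\<And>a. a \<notin> I \<Longrightarrow> F a = 0" for F
  proof -
    have "(\<Sum>r\<in>J. x r * F (h r)) = (\<Sum>a\<in>I \<union> h ` J. \<Sum>r | r \<in> J \<and> h r = a. x r * F (h r))"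
      using assms by (intro sum.group[symmetric]) auto
    also have "\<dots> = (\<Sum>a\<in>I \<union> h ` J. y a * F a)"
      by (simp add: y_def sum_distrib_right)
    also have "\<dots> = (\<Sum>a\<in>I. y a * F a)"
      using assms F by (intro sum.mono_neutral_right) auto
    finally show ?thesis .
  qed
  have "(\<Sum>r\<in>J. \<Sum>s\<in>J. x r * x s * Y (h r) (h s)) = (\<Sum>r\<in>J. x r * (\<Sum>s\<in>J. x s * Y (h r) (h s)))"
    by (simp add: sum_distrib_left ac_simps)
  also have "\<dots> = (\<Sum>r\<in>J. x r * (\<Sum>b\<in>I. y b * Y (h r) b))"
    by (intro sum.cong refl arg_cong2[where f = "(*)"] collapse out) blast
  also have "\<dots> = (\<Sum>a\<in>I. y a * (\<Sum>b\<in>I. y b * Y a b))"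
    by (intro collapse) (simp add: out)
  also have "\<dots> = (\<Sum>a\<in>I. \<Sum>b\<in>I. y a * y b * Y a b)"
    by (simp add: sum_distrib_left ac_simps)
  also have "\<dots> \<ge> 0" using assms(3) unfolding sym_psd_iff by blast
  finally show "(\<Sum>r\<in>J. \<Sum>s\<in>J. x r * x s * Y (h r) (h s)) \<ge> 0" .
qed

lemma add_fixed_lift_vec:
  "add_fixed Z (lift_vec c (c *\<^sub>R x)) = lift_vec c (c *\<^sub>R (\<lambda>v. if v \<in> Z then 1 else x v))"
  unfolding add_fixed_def by (rule lift_vec_eqI) auto

lemma add_fixed_lift_cone:
  assumes "\<And>x. x \<in> P \<Longrightarrow> (\<lambda>v. if v \<in> Z then 1 else x v) \<in> Q" "y \<in> lift_cone P"
  shows "add_fixed Z y \<in> lift_cone Q"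
proof -
  obtain c x where "0 \<le> c" "x \<in> P" "y = lift_vec c (c *\<^sub>R x)"
    using assms(2) by (rule lift_coneE)
  then show ?thesis using assms(1) by (simp only: add_fixed_lift_vec lift_coneI)
qed

text \<open>The matrix for \<open>W\<close> is pulled back along \<open>fix_coord Z\<close>. Columns
  in \<open>Z\<close> become copies of column \<open>None\<close> with zero complement, columns
  outside \<open>W\<close> and \<open>Z\<close> are zero with complement column \<open>None\<close>,
  and the others are carried from \<open>P\<close> to \<open>Q\<close>.\<close>

lemma LS_plus_fix_coords:
  assumes V: "finite V" and W: "W \<subseteq> V" "W \<noteq> {}" and Z: "Z \<subseteq> V" "Z \<inter> W = {}"
    and P: "convex P"
    and PQ: "\<And>x. x \<in> P \<Longrightarrow> (\<lambda>v. if v \<in> Z then 1 else x v) \<in> Q"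
    and x: "x \<in> LS_plus W P"
  shows "(\<lambda>v. if v \<in> Z then 1 else x v) \<in> LS_plus V Q"
proof -
  have finW: "finite W" using V W finite_subset by blast
  obtain Y where Y: "Y \<in> sym_psd (coords W)" "\<And>r. Y r None = Y r r"
      "\<And>i. i \<in> W \<Longrightarrow> (\<lambda>r. Y r (Some i)) \<in> lift_cone P"
      "\<And>i. i \<in> W \<Longrightarrow> (\<lambda>r. Y r None - Y r (Some i)) \<in> lift_cone P"
      "(\<lambda>r. Y r None) = lift_vec 1 x"
    using x unfolding LS_plus_iff[OF finW] by blast
  have xP: "x \<in> P" using LS_plus_subset[OF finW W(2) P] x by blast
  define h where "h = fix_coord Z"
  have h: "h None = None" "h (Some i) = (if i \<in> Z then None else Some i)" for i
    by (simp_all add: h_def fix_coord_def)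
  have col: "(\<lambda>r. y (h r)) \<in> lift_cone Q" if "y \<in> lift_cone P" for y
    using add_fixed_lift_cone[OF PQ that] by (simp add: add_fixed_eq h_def)
  have col0: "(\<lambda>r. Y (h r) None) \<in> lift_cone Q"
    using col[of "\<lambda>r. Y r None"] xP by (simp add: Y(5))
  have zero: "(\<lambda>r. 0) \<in> lift_cone Q"
    using zero_in_lift_cone[of Q] PQ[OF xP] by (auto simp: zero_fun_def)
  have "(\<lambda>r s. Y (h r) (h s)) \<in> sym_psd (coords V)"
  proof (rule sym_psd_reindex[OF _ _ Y(1)])
    fix r assume "r \<notin> coords V"
    then show "h r \<notin> coords W" using W Z by (cases r) (auto simp: h)
  qed (use V finW in auto)
  moreover have "Y (h r) (h None) = Y (h r) (h r)" for r using Y(2) by (simp add: h)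
  moreover have "(\<lambda>r. Y (h r) (h (Some i))) \<in> lift_cone Q \<and>
      (\<lambda>r. Y (h r) (h None) - Y (h r) (h (Some i))) \<in> lift_cone Q" if "i \<in> V" for i
  proof -
    consider "i \<in> Z" | "i \<in> W" "i \<notin> Z" | "i \<notin> W" "i \<notin> Z" by blast
    then show ?thesis
    proof cases
      case 1
      then show ?thesis using col0 zero by (simp add: h)
    next
      case 2
      then show ?thesis using col[OF Y(3)] col[OF Y(4)] by (simp add: h)
    next
      case 3
      then have "Y r (Some i) = 0" for r using Y(1) unfolding sym_psd_iff by auto
      then show ?thesis using 3 col0 zero by (simp add: h)
    qed
  qed
  moreover have "(\<lambda>r. Y (h r) (h None)) = lift_vec 1 (\<lambda>v. if v \<in> Z then 1 else x v)"
    using fun_cong[OF Y(5)] by (intro lift_vec_eqI) (simp_all add: h)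
  ultimately show ?thesis unfolding LS_plus_iff[OF V]
    by (intro bexI[where x = "\<lambda>r s. Y (h r) (h s)"]) auto
qed

text \<open>Fixing a stable set \<open>Z\<close> without neighbours in \<open>W\<close> violates no
  edge constraint, and \<open>LS_plus_fix_coords\<close> carries the fixing through each round. It
  is applied with \<open>Z\<close> a single hub and with \<open>Z\<close> empty.\<close>

lemma LS_plus_graph_induced_fix:
  assumes V: "finite (verts G)" and W: "W \<subseteq> verts G" "W \<noteq> {}" and Z: "Z \<inter> W = {}" "stable_set G Z"
    and WZ: "\<And>w z. w \<in> W \<Longrightarrow> z \<in> Z \<Longrightarrow> {w, z} \<notin> edges G"
    and E: "\<And>e. e \<in> edges G \<Longrightarrow> e \<subseteq> verts G"
    and x: "x \<in> LS_plus_graph m (induced G W)"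
  shows "(\<lambda>v. if v \<in> Z then 1 else x v) \<in> LS_plus_graph m G"
  using x
proof (induction m arbitrary: x)
  case 0
  have ZV: "Z \<subseteq> verts G" using Z by (simp add: stable_set_def)
  have x: "x v \<in> {0..1}" "v \<notin> W \<Longrightarrow> x v = 0" for v
    using 0 W by (auto simp: FRAC_def fun_power_def)+
  have xe: "x i + x j \<le> 1" if "{i, j} \<in> edges G" "i \<in> W" "j \<in> W" for i j
    using 0 that by (auto simp: FRAC_def)
  have "(if i \<in> Z then 1 else x i) + (if j \<in> Z then 1 else x j) \<le> 1" if e: "{i, j} \<in> edges G" for i j
  proof -
    have ij: "i \<in> verts G" "j \<in> verts G" using E[OF e] by auto
    have e': "{j, i} \<in> edges G" using e by (simp add: insert_commute)
    consider "i \<in> W" "j \<in> W" | "i \<notin> W" | "j \<notin> W" by blast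
    then show ?thesis
    proof cases
      case 1
      then show ?thesis using xe[OF e] Z by auto
    next
      case 2
      have "\<not> (i \<in> Z \<and> j \<in> Z)" using e Z(2) by (auto simp: stable_set_def)
      moreover have "\<not> (i \<in> Z \<and> j \<in> W)" using e' WZ by blast
      ultimately show ?thesis using 2 x(1)[of j] x(2)[of i] x(2)[of j] by auto
    next
      case 3
      have "\<not> (i \<in> Z \<and> j \<in> Z)" using e Z(2) by (auto simp: stable_set_def)
      moreover have "\<not> (j \<in> Z \<and> i \<in> W)" using e WZ by blast
      ultimately show ?thesis using 3 x(1)[of i] x(2)[of j] x(2)[of i] by auto
    qed
  qed
  moreover have "(if v \<in> Z then 1 else x v) = 0" if "v \<notin> verts G" for v
    using that ZV W x(2)[of v] by auto
  ultimately show ?case using x(1) by (auto simp: FRAC_def fun_power_def)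
next
  case (Suc m)
  have "verts (induced G W) = W" using W by auto
  moreover have "finite W" using W V finite_subset by blast
  ultimately have "convex (LS_plus_graph m (induced G W))" "x \<in> LS_plus W (LS_plus_graph m (induced G W))"
    using Suc.prems by (auto intro: convex_LS_plus_graph)
  then show ?case
    using LS_plus_fix_coords[OF V W, of Z "LS_plus_graph m (induced G W)" "LS_plus_graph m G" x] Suc.IH Z
    by (auto simp: stable_set_def)
qed

section \<open>The iterates reach the stable set polytope\<close>

text \<open>A convex combination is tight for a valid inequality only if every member of positive
  weight is. The factor \<open>t\<close> lets \<open>t = -1\<close>, \<open>c = 0\<close> cover the
  face \<open>x j = 0\<close> and \<open>t = 1\<close>, \<open>c = 1\<close> the face
  \<open>x j = 1\<close>.\<close>

lemma convex_hull_face: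
  fixes Q :: "('a \<Rightarrow> real) set"
  assumes "\<And>x. x \<in> Q \<Longrightarrow> t * x j \<le> c" "x \<in> convex hull Q" "t * x j = c"
  shows "x \<in> convex hull (Q \<inter> {x. t * x j = c})"
proof -
  let ?H = "convex hull (Q \<inter> {x. t * x j = c})"
  have "convex {x. t * x j \<le> c \<and> (t * x j = c \<longrightarrow> x \<in> ?H)}"
  proof (rule convexI)
    fix x y :: "'a \<Rightarrow> real" and a b :: real
    assume x: "x \<in> {x. t * x j \<le> c \<and> (t * x j = c \<longrightarrow> x \<in> ?H)}"
      and y: "y \<in> {x. t * x j \<le> c \<and> (t * x j = c \<longrightarrow> x \<in> ?H)}"
      and ab: "0 \<le> a" "0 \<le> b" "a + b = 1"
    have eq: "t * (a *\<^sub>R x + b *\<^sub>R y) j = a * (t * x j) + b * (t * y j)"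
      by (simp add: algebra_simps)
    have le: "a * (t * x j) \<le> a * c" "b * (t * y j) \<le> b * c"
      using x y ab by (auto intro: mult_left_mono)
    have c: "c = a * c + b * c" using ab by (metis distrib_right mult_1)
    have "a *\<^sub>R x + b *\<^sub>R y \<in> ?H" if "t * (a *\<^sub>R x + b *\<^sub>R y) j = c"
    proof -
      have "a * (t * x j) = a * c" "b * (t * y j) = b * c" using that eq le c by linarith+
      then have "a = 0 \<or> x \<in> ?H" "b = 0 \<or> y \<in> ?H" using x y by auto
      then show ?thesis
        using ab convexD[OF convex_convex_hull, of x "Q \<inter> {x. t * x j = c}" y a b] by auto
    qed
    moreover have "t * (a *\<^sub>R x + b *\<^sub>R y) j \<le> c" using eq le c by linarith
    ultimately show "a *\<^sub>R x + b *\<^sub>R y \<in> {x. t * x j \<le> c \<and> (t * x j = c \<longrightarrow> x \<in> ?H)}" by blast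
  qed
  moreover have "Q \<subseteq> {x. t * x j \<le> c \<and> (t * x j = c \<longrightarrow> x \<in> ?H)}"
    using assms(1) hull_inc[of _ "Q \<inter> {x. t * x j = c}" convex] by auto
  ultimately have "convex hull Q \<subseteq> {x. t * x j \<le> c \<and> (t * x j = c \<longrightarrow> x \<in> ?H)}"
    by (rule hull_minimal[rotated])
  then show ?thesis using assms(2,3) by blast
qed

text \<open>\<open>x\<close> is the sum of column \<open>j\<close> and its complement. By the
  diagonal condition the points behind these two cone elements have \<open>j\<close>-coordinate 1
  and 0, unless their weight vanishes; so one round decides one coordinate.\<close>

lemma LS_plus_split:
  assumes V: "finite V" and j: "j \<in> V" and x: "x \<in> LS_plus V P"
  shows "x \<in> convex hull (P \<inter> {x. x j \<in> {0, 1}})"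
proof -
  let ?H = "convex hull (P \<inter> {x. x j \<in> {0, 1}})"
  obtain Y where Y: "Y \<in> sym_psd (coords V)" "\<And>r. Y r None = Y r r"
      "(\<lambda>r. Y r (Some j)) \<in> lift_cone P" "(\<lambda>r. Y r None - Y r (Some j)) \<in> lift_cone P"
      "(\<lambda>r. Y r None) = lift_vec 1 x"
    using x j unfolding LS_plus_iff[OF V] by blast
  have sym: "Y r s = Y s r" for r s using Y(1) unfolding sym_psd_iff by blast
  have Y0: "Y (Some v) None = x v" "Y None None = 1" for v
    using fun_cong[OF Y(5), of "Some v"] fun_cong[OF Y(5), of None] by auto
  obtain c y where y: "0 \<le> c" "y \<in> P" and yeq: "(\<lambda>r. Y r (Some j)) = lift_vec c (c *\<^sub>R y)"
    using Y(3) by (rule lift_coneE)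
  obtain c' z where z: "0 \<le> c'" "z \<in> P"
    and zeq: "(\<lambda>r. Y r None - Y r (Some j)) = lift_vec c' (c' *\<^sub>R z)"
    using Y(4) by (rule lift_coneE)
  have c: "c = x j" using fun_cong[OF yeq, of None] sym[of None "Some j"] Y0 by simp
  have c': "c' = 1 - x j" using fun_cong[OF zeq, of None] sym[of None "Some j"] Y0 by simp
  have "c * y j = c" using fun_cong[OF yeq, of "Some j"] Y(2)[of "Some j"] Y0 c by simp
  then have yH: "c = 0 \<or> y \<in> ?H" using y(2) by (auto intro!: hull_inc)
  have "c' * z j = 0" using fun_cong[OF zeq, of "Some j"] Y(2)[of "Some j"] Y0 by simp
  then have zH: "c' = 0 \<or> z \<in> ?H" using z(2) by (auto intro!: hull_inc)
  have "x v = c * y v + c' * z v" for v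
    using fun_cong[OF yeq, of "Some v"] fun_cong[OF zeq, of "Some v"] Y0 by simp
  then have "x = c *\<^sub>R y + c' *\<^sub>R z" by auto
  moreover have "c + c' = 1" using c c' by simp
  ultimately show ?thesis
    using yH zH y(1) z(1) convexD[OF convex_convex_hull, of y _ z c c'] by auto
qed

text \<open>One coordinate is made integral per round. Those of earlier rounds stay integral because
  \<open>x j = 0\<close> and \<open>x j = 1\<close> cut out faces of the hull obtained so
  far.\<close>

lemma LS_plus_power_subset:
  assumes V: "finite V" and P: "P \<subseteq> fun_power V {0..1}" "convex P" and J: "finite J" "J \<subseteq> V"
  shows "(LS_plus V ^^ card J) P \<subseteq> convex hull (P \<inter> {x. \<forall>j\<in>J. x j \<in> {0, 1}})"
  using J
proof (induction J rule: finite_induct)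
  case empty
  then show ?case using hull_subset[of P convex] by auto
next
  case (insert j J)
  let ?Q = "P \<inter> {x. \<forall>j\<in>J. x j \<in> {0, 1}}" and ?R = "P \<inter> {x. \<forall>j\<in>insert j J. x j \<in> {0, 1}}"
  let ?L = "(LS_plus V ^^ card J) P"
  have IH: "?L \<subseteq> convex hull ?Q" using insert by blast
  have "LS_plus V ?L \<subseteq> convex hull (?L \<inter> {x. x j \<in> {0, 1}})"
    using LS_plus_split[OF V, of j] insert.prems by blast
  also have "\<dots> \<subseteq> convex hull ?R"
  proof (intro hull_minimal convex_convex_hull subsetI)
    fix x assume x: "x \<in> ?L \<inter> {x. x j \<in> {0, 1}}"
    have Q: "0 \<le> y j" "y j \<le> 1" if "y \<in> ?Q" for y
      using that P(1) insert.prems by (auto simp: fun_power_def)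
    from x have "x j = 0 \<or> x j = 1" by simp
    then show "x \<in> convex hull ?R"
    proof
      assume "x j = 0"
      then have "x \<in> convex hull (?Q \<inter> {x. -1 * x j = 0})"
        using Q x IH by (intro convex_hull_face) auto
      also have "\<dots> \<subseteq> convex hull ?R" by (rule hull_mono) auto
      finally show ?thesis .
    next
      assume "x j = 1"
      then have "x \<in> convex hull (?Q \<inter> {x. 1 * x j = 1})"
        using Q x IH by (intro convex_hull_face) auto
      also have "\<dots> \<subseteq> convex hull ?R" by (rule hull_mono) auto
      finally show ?thesis .
    qed
  qed
  finally show ?case using insert.hyps by simp
qed

lemma FRAC_zero_one_stable:
  assumes "x \<in> FRAC G \<inter> fun_power (verts G) {0, 1}"
  shows "\<exists>S. stable_set G S \<and> x = indicat_real S"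
proof -
  let ?S = "{v \<in> verts G. x v = 1}"
  have "x = indicat_real ?S" using assms by (intro ext) (auto simp: fun_power_def indicator_def)
  moreover have "stable_set G ?S"
    using assms by (force simp: stable_set_def FRAC_def)
  ultimately show ?thesis by blast
qed

text \<open>Running over all vertices makes every coordinate integral; this shows that the least
  index in \<open>LS_plus_rank\<close> is attained.\<close>

lemma LS_plus_graph_card_verts:
  assumes V: "finite (verts G)"
  shows "LS_plus_graph (card (verts G)) G = STAB G"
proof
  have P: "FRAC G \<subseteq> fun_power (verts G) {0..1}" by (auto simp: FRAC_def)
  have eq: "FRAC G \<inter> {x. \<forall>j\<in>verts G. x j \<in> {0, 1}} = FRAC G \<inter> fun_power (verts G) {0, 1}"
    by (auto simp: FRAC_def fun_power_def)
  show "LS_plus_graph (card (verts G)) G \<subseteq> STAB G"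
    using LS_plus_power_subset[OF V P convex_FRAC V order_refl]
    unfolding LS_plus_graph_def STAB_def integer_hull_def eq .
  show "STAB G \<subseteq> LS_plus_graph (card (verts G)) G"
    unfolding STAB_def integer_hull_def
    using FRAC_zero_one_stable stable_indicator_in_LS_plus_graph[OF V]
    by (intro hull_minimal convex_LS_plus_graph V) blast
qed

section \<open>Structure of stretched cliques\<close>

abbreviation hub :: "nat \<Rightarrow> vertex" where
  "hub i \<equiv> Sub (Orig i) 0"

abbreviation wing :: "nat \<Rightarrow> nat \<Rightarrow> vertex" where
  "wing i a \<equiv> Sub (Orig i) a"

lemma stable_set_subset: "stable_set G S \<Longrightarrow> T \<subseteq> S \<Longrightarrow> stable_set G T"
  by (auto simp: stable_set_def)

lemma clique_induced: "clique (induced G W) C \<Longrightarrow> clique G C"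
  by (auto simp: clique_def)

section \<open>Stretched cliques described by adjacency rules\<close>

text \<open>An arbitrary finite index set \<open>I\<close> replaces \<open>{1..n}\<close> because
  the induction deletes indices. Collected here are rules that survive each single stretching; the
  condition on pairs of stretched indices concerns the final graph and is added in the extended
  locale.\<close>

locale stretched_clique_base =
  fixes I D :: "nat set" and G :: "vertex graph"
  assumes finite_I: "finite I" and D_subset: "D \<subseteq> I"
    and verts_eq: "verts G = Orig ` (I - D) \<union> hub ` D \<union> (\<lambda>i. wing i 1) ` D \<union> (\<lambda>i. wing i 2) ` D"
    and edgeE: "e \<in> edges G \<Longrightarrow> \<exists>x y. x \<in> verts G \<and> y \<in> verts G \<and> x \<noteq> y \<and> e = {x, y}"
    and orig_orig_edge: "u \<in> I - D \<Longrightarrow> w \<in> I - D \<Longrightarrow> u \<noteq> w \<Longrightarrow> {Orig u, Orig w} \<in> edges G"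
    and hub_edge_iff: "i \<in> D \<Longrightarrow> {hub i, y} \<in> edges G \<longleftrightarrow> y = wing i 1 \<or> y = wing i 2"
    and wings_nonadjacent: "i \<in> D \<Longrightarrow> {wing i 1, wing i 2} \<notin> edges G"
    and wing_orig_edge: "i \<in> D \<Longrightarrow> u \<in> I - D \<Longrightarrow> \<exists>a\<in>{1, 2}. {wing i a, Orig u} \<in> edges G"
begin

lemma finite_D: "finite D"
  using finite_I D_subset finite_subset by blast

lemma finite_verts: "finite (verts G)"
  using finite_I finite_D by (simp add: verts_eq)

lemma edge_subset: "e \<in> edges G \<Longrightarrow> e \<subseteq> verts G"
  using edgeE by blast

lemma no_loop: "{x} \<notin> edges G"
  using edgeE[of "{x}"] by (metis doubleton_eq_iff insert_absorb2)

lemma hub_edge_iff': "i \<in> D \<Longrightarrow> {y, hub i} \<in> edges G \<longleftrightarrow> y = wing i 1 \<or> y = wing i 2"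
  using hub_edge_iff by (metis insert_commute)

lemma stretched_verts_eq: "stretched_verts G = D"
  by (auto simp: stretched_verts_def verts_eq)

lemma hubs_eq: "hubs G = hub ` D"
  by (simp add: hubs_def stretched_verts_eq)

definition part :: "nat \<Rightarrow> vertex set" where
  "part i = (if i \<in> D then {hub i, wing i 1, wing i 2} else {Orig i})"

text \<open>The overview's \<open>S\<^sub>j\<close>, at \<open>j = i\<close>. It differs from the
  hubs only inside \<open>part i\<close> and has one vertex more than \<open>D\<close> has
  elements.\<close>

definition top_set :: "nat \<Rightarrow> vertex set" where
  "top_set i = (if i \<in> D then hubs G - {hub i} \<union> {wing i 1, wing i 2} else insert (Orig i) (hubs G))"

lemma verts_parts: "verts G = (\<Union>i\<in>I. part i)"
  using D_subset by (auto simp: verts_eq part_def)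

lemma part_disjoint: "i \<noteq> j \<Longrightarrow> part i \<inter> part j = {}"
  by (auto simp: part_def)

lemma part_subset: "i \<in> I \<Longrightarrow> part i \<subseteq> verts G"
  using verts_parts by blast

lemma hubs_subset: "hubs G \<subseteq> verts G"
  by (auto simp: hubs_eq verts_eq)

lemma finite_hubs: "finite (hubs G)"
  by (simp add: hubs_eq finite_D)

lemma card_hubs: "card (hubs G) = card D"
  unfolding hubs_eq by (rule card_image) (auto simp: inj_on_def)

lemma stable_insert:
  assumes "stable_set G S" "v \<in> verts G" "\<And>s. s \<in> S \<Longrightarrow> {v, s} \<notin> edges G"
  shows "stable_set G (insert v S)"
  using assms no_loop[of v] by (auto simp: stable_set_def insert_commute)

lemma stable_hubs: "stable_set G (hubs G)"
  using hubs_subset by (auto simp: stable_set_def hubs_eq hub_edge_iff)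

lemma top_set_stable:
  assumes "i \<in> I"
  shows "stable_set G (top_set i)"
proof (cases "i \<in> D")
  case True
  have "stable_set G (insert (wing i 1) (insert (wing i 2) (hubs G - {hub i})))"
    using True wings_nonadjacent
    by (intro stable_insert stable_set_subset[OF stable_hubs])
       (auto simp: verts_eq hubs_eq hub_edge_iff')
  moreover have "top_set i = insert (wing i 1) (insert (wing i 2) (hubs G - {hub i}))"
    using True by (auto simp: top_set_def)
  ultimately show ?thesis by simp
next
  case False
  have "stable_set G (insert (Orig i) (hubs G))"
    using False assms by (intro stable_insert stable_hubs) (auto simp: verts_eq hubs_eq hub_edge_iff')
  then show ?thesis using False by (simp add: top_set_def)
qed

lemma card_top_set: "card (top_set i) = card D + 1"
proof (cases "i \<in> D")
  case True
  have "top_set i = insert (wing i 1) (insert (wing i 2) (hubs G - {hub i}))"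
    using True by (auto simp: top_set_def)
  moreover have "wing i 1 \<notin> insert (wing i 2) (hubs G - {hub i})" "wing i 2 \<notin> hubs G - {hub i}"
    by (auto simp: hubs_eq)
  moreover have "card (hubs G - {hub i}) = card D - 1" "card D > 0"
    using True card_hubs finite_hubs finite_D by (auto simp: hubs_eq card_gt_0_iff)
  ultimately show ?thesis using finite_hubs by simp
next
  case False
  moreover have "Orig i \<notin> hubs G" by (auto simp: hubs_eq)
  ultimately show ?thesis using finite_hubs card_hubs by (simp add: top_set_def)
qed

lemma top_set_subset: "top_set i \<subseteq> hubs G \<union> part i"
  by (auto simp: top_set_def part_def)

lemma hub_in_top_set: "j \<in> D \<Longrightarrow> hub j \<in> top_set i \<longleftrightarrow> j \<noteq> i"
  by (auto simp: top_set_def hubs_eq)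

lemma wing_in_top_set: "a \<in> {1, 2} \<Longrightarrow> wing j a \<in> top_set i \<longleftrightarrow> j = i \<and> i \<in> D"
  by (auto simp: top_set_def hubs_eq)

lemma orig_in_top_set: "Orig j \<in> top_set i \<longleftrightarrow> j = i \<and> i \<notin> D"
  by (auto simp: top_set_def hubs_eq)

definition far :: "nat \<Rightarrow> nat \<Rightarrow> nat \<Rightarrow> bool" where
  "far i a u \<longleftrightarrow> u \<in> I \<and> u \<noteq> i \<and> (\<forall>x\<in>part u. {wing i a, x} \<notin> edges G)"

text \<open>Exchanging the hub of \<open>i\<close> for a wing that is far from \<open>u\<close>
  yields further stable sets of maximum size, from which the columns of the certificate may
  subtract.\<close>

definition swap_set :: "nat \<Rightarrow> nat \<Rightarrow> nat \<Rightarrow> vertex set" where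
  "swap_set i a u = insert (wing i a) (top_set u - {hub i})"

lemma swap_set_stable:
  assumes "i \<in> D" "a \<in> {1, 2}" "far i a u"
  shows "stable_set G (swap_set i a u)"
  unfolding swap_set_def
proof (rule stable_insert)
  show "stable_set G (top_set u - {hub i})"
    using assms by (intro stable_set_subset[OF top_set_stable]) (auto simp: far_def)
  show "wing i a \<in> verts G" using assms by (auto simp: verts_eq)
  fix s assume s: "s \<in> top_set u - {hub i}"
  show "{wing i a, s} \<notin> edges G"
  proof (cases "s \<in> part u")
    case True
    then show ?thesis using assms by (auto simp: far_def)
  next
    case False
    \<comment> \<open>Outside \<open>part u\<close> the set \<open>top_set u\<close> consists of
      hubs. A hub sees only its own two wings, and \<open>hub i\<close> has been removed.\<close>
    then have "s \<in> hubs G" using s top_set_subset by blast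
    then show ?thesis using s by (auto simp: hubs_eq hub_edge_iff')
  qed
qed

lemma card_swap_set:
  assumes "i \<in> D" "a \<in> {1, 2}" "far i a u"
  shows "card (swap_set i a u) = card D + 1"
proof -
  have "hub i \<in> top_set u" "wing i a \<notin> top_set u"
    using assms by (auto simp: hub_in_top_set wing_in_top_set far_def)
  moreover have "finite (top_set u)" using card_top_set[of u] by (auto intro: card_ge_0_finite)
  ultimately show ?thesis using card_top_set[of u] card_Suc_Diff1[of "top_set u" "hub i"]
    by (simp add: swap_set_def)
qed

end

locale stretched_clique_exact = stretched_clique_base +
  assumes wing_wing_edge: "i \<in> D \<Longrightarrow> j \<in> D \<Longrightarrow> i \<noteq> j \<Longrightarrow>
    \<exists>!p. p \<in> {1, 2} \<times> {1, 2} \<and> {wing i (fst p), wing j (snd p)} \<in> edges G"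
begin

lemma wing_wing_edge_ex:
  assumes "i \<in> D" "j \<in> D" "i \<noteq> j"
  obtains a b where "a \<in> {1, 2}" "b \<in> {1, 2}" "{wing i a, wing j b} \<in> edges G"
  using ex1_implies_ex[OF wing_wing_edge[OF assms]] by auto

lemma wing_wing_edge_unique:
  assumes "i \<in> D" "j \<in> D" "i \<noteq> j" "a \<in> {1, 2}" "b \<in> {1, 2}" "a' \<in> {1, 2}" "b' \<in> {1, 2}"
    and "{wing i a, wing j b} \<in> edges G" "{wing i a', wing j b'} \<in> edges G"
  shows "a = a' \<and> b = b'"
proof -
  have "(a, b) = (a', b')"
    using wing_wing_edge[OF assms(1-3)] assms(4-) by (metis (no_types, lifting) SigmaI fst_conv snd_conv)
  then show ?thesis by simp
qed

text \<open>Some wing of \<open>i\<close> always has a neighbour in the part of any other index, so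
  both wings cannot be far from the same one.\<close>

lemma far_distinct:
  assumes "i \<in> D" "far i 1 u" "far i 2 w"
  shows "u \<noteq> w"
proof
  assume "u = w"
  then have u: "u \<in> I" "u \<noteq> i" "\<And>a x. a \<in> {1, 2} \<Longrightarrow> x \<in> part u \<Longrightarrow> {wing i a, x} \<notin> edges G"
    using assms by (auto simp: far_def)
  show False
  proof (cases "u \<in> D")
    case True
    obtain a b where "a \<in> {1, 2}" "b \<in> {1, 2}" "{wing i a, wing u b} \<in> edges G"
      using wing_wing_edge_ex[OF assms(1) True] u by metis
    then show False using u(3)[of a "wing u b"] True by (auto simp: part_def)
  next
    case False
    then show False using wing_orig_edge[OF assms(1), of u] u by (auto simp: part_def)
  qed
qed

text \<open>A hub excludes its wings, so a stretched index contributes at most one vertex unless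
  both wings are taken. The set \<open>X\<close> holds the indices that contribute one vertex beyond
  this count: those with both wings, and the unstretched ones that are used. Two such indices would
  be joined by an edge.\<close>

lemma card_stable_le:
  assumes "stable_set G S"
  shows "card S \<le> card D + 1"
proof -
  define X where "X = {i \<in> I. if i \<in> D then wing i 1 \<in> S \<and> wing i 2 \<in> S else Orig i \<in> S}"
  have nadj: "{x, y} \<notin> edges G" if "x \<in> S" "y \<in> S" for x y
    using assms that by (auto simp: stable_set_def)
  have "i = j" if ij: "i \<in> X" "j \<in> X" for i j
  proof (rule ccontr)
    assume "i \<noteq> j"
    consider "i \<in> D" "j \<in> D" | "i \<in> D" "j \<notin> D" | "i \<notin> D" "j \<in> D" | "i \<notin> D" "j \<notin> D" by blast
    then show False
    proof cases
      case 1
      obtain a b where "a \<in> {1, 2}" "b \<in> {1, 2}" "{wing i a, wing j b} \<in> edges G"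
        using wing_wing_edge_ex[OF 1 \<open>i \<noteq> j\<close>] by metis
      then show False using 1 that nadj[of "wing i a" "wing j b"] by (auto simp: X_def)
    next
      case 2
      then obtain a where "a \<in> {1, 2}" "{wing i a, Orig j} \<in> edges G"
        using wing_orig_edge[of i j] ij unfolding X_def by blast
      then show False using 2 that nadj[of "wing i a" "Orig j"] by (auto simp: X_def)
    next
      case 3
      then obtain a where "a \<in> {1, 2}" "{wing j a, Orig i} \<in> edges G"
        using wing_orig_edge[of j i] ij unfolding X_def by blast
      then show False using 3 that nadj[of "wing j a" "Orig i"] by (auto simp: X_def)
    next
      case 4
      then show False using orig_orig_edge[of i j] \<open>i \<noteq> j\<close> that nadj[of "Orig i" "Orig j"]
        by (auto simp: X_def)
    qed
  qed
  moreover have finX: "finite X" using finite_I by (simp add: X_def)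
  ultimately have X: "card X \<le> 1" by (simp add: card_le_Suc0_iff_eq)
  have part_le: "card (S \<inter> part i) \<le> (if i \<in> D then 1 else 0) + (if i \<in> X then 1 else 0)" if "i \<in> I" for i
  proof (cases "i \<in> D")
    case True
    show ?thesis
    proof (cases "hub i \<in> S")
      case h: True
      then have "wing i 1 \<notin> S" "wing i 2 \<notin> S"
        using nadj[OF h] hub_edge_iff[OF True] by auto
      then have "S \<inter> part i \<subseteq> {hub i}" using True by (auto simp: part_def)
      then have "card (S \<inter> part i) \<le> card {hub i}" by (intro card_mono) auto
      then show ?thesis using True by simp
    next
      case h: False
      show ?thesis
      proof (cases "wing i 1 \<in> S \<and> wing i 2 \<in> S")
        case w: True
        have "card (S \<inter> part i) \<le> card {wing i 1, wing i 2}"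
          using h True by (intro card_mono) (auto simp: part_def)
        then show ?thesis using True w that by (simp add: X_def)
      next
        case w: False
        then obtain a where "S \<inter> part i \<subseteq> {wing i a}" using h True by (auto simp: part_def)
        then have "card (S \<inter> part i) \<le> card {wing i a}" by (intro card_mono) auto
        then show ?thesis using True by simp
      qed
    qed
  next
    case False
    show ?thesis
    proof (cases "Orig i \<in> S")
      case True
      then have "S \<inter> part i = {Orig i}" using False by (auto simp: part_def)
      then show ?thesis using True False that by (simp add: X_def)
    next
      case o: False
      then have "S \<inter> part i = {}" using False by (auto simp: part_def)
      then show ?thesis by simp
    qed
  qed
  have "S = (\<Union>i\<in>I. S \<inter> part i)" using assms verts_parts by (auto simp: stable_set_def)
  then have "card S \<le> (\<Sum>i\<in>I. card (S \<inter> part i))" using card_UN_le[OF finite_I] by metis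
  also have "\<dots> \<le> (\<Sum>i\<in>I. (if i \<in> D then 1 else 0) + (if i \<in> X then 1 else 0))"
    by (rule sum_mono) (rule part_le)
  also have "\<dots> = card (I \<inter> D) + card (I \<inter> X)"
    using finite_I by (simp add: sum.distrib sum.If_cases Collect_mem_eq)
  also have "\<dots> = card D + card X"
    using D_subset by (intro arg_cong2[where f = "(+)"] arg_cong[where f = card]) (auto simp: X_def)
  also have "\<dots> \<le> card D + 1" using X by simp
  finally show ?thesis .
qed

text \<open>
  If every stretched index had a wing adjacent to all other indices, then these wings would form
  an \<open>|I|\<close>-clique together with the unstretched vertices, since between two stretched indices
  there is only one edge.
\<close>

lemma far_exists:
  assumes "\<And>C. clique G C \<Longrightarrow> card C < card I"
  obtains i u w where "i \<in> D" "far i 1 u" "far i 2 w"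
proof -
  have "\<exists>i\<in>D. \<forall>a\<in>{1, 2}. \<exists>u. far i a u"
  proof (rule ccontr)
    assume "\<not> ?thesis"
    then have "\<forall>i\<in>D. \<exists>a. a \<in> {1, 2} \<and> (\<forall>u. \<not> far i a u)" by blast
    then obtain a where a: "\<And>i. i \<in> D \<Longrightarrow> a i \<in> {1, 2}" "\<And>i u. i \<in> D \<Longrightarrow> \<not> far i (a i) u"
      using bchoice[of D "\<lambda>i a. a \<in> {1, 2} \<and> (\<forall>u. \<not> far i a u)"] by metis
    have univ: "\<exists>x\<in>part u. {wing i (a i), x} \<in> edges G" if "i \<in> D" "u \<in> I" "u \<noteq> i" for i u
      using a(2)[OF that(1), of u] that by (auto simp: far_def)
    have wing_orig: "{wing i (a i), Orig u} \<in> edges G" if "i \<in> D" "u \<in> I - D" for i u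
      using univ[of i u] that by (auto simp: part_def)
    have univ_wing: "\<exists>b\<in>{1, 2}. {wing i (a i), wing j b} \<in> edges G"
      if ij: "i \<in> D" "j \<in> D" "i \<noteq> j" for i j
    proof -
      have "\<exists>x\<in>part j. {wing i (a i), x} \<in> edges G"
        using univ[of i j] ij D_subset by blast
      then show ?thesis using ij by (auto simp: part_def hub_edge_iff')
    qed
    have wing_wing: "{wing i (a i), wing j (a j)} \<in> edges G" if ij: "i \<in> D" "j \<in> D" "i \<noteq> j" for i j
    proof -
      obtain b where b: "b \<in> {1, 2}" "{wing i (a i), wing j b} \<in> edges G"
        using univ_wing[OF ij] by blast
      obtain c where c: "c \<in> {1, 2}" "{wing j (a j), wing i c} \<in> edges G"
        using univ_wing[of j i] ij by blast
      have "{wing i c, wing j (a j)} \<in> edges G" using c(2) by (simp add: insert_commute)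
      \<comment> \<open>Both edges are the single edge between the wings of \<open>i\<close> and
        those of \<open>j\<close>, so the neighbour found from \<open>i\<close> is the wing chosen
        for \<open>j\<close>.\<close>
      then have "b = a j"
        using wing_wing_edge_unique[OF ij, of "a i" b c "a j"] a(1) b c ij by blast
      then show ?thesis using b by simp
    qed
    define g where "g = (\<lambda>i. if i \<in> D then wing i (a i) else Orig i)"
    have "clique G (g ` I)"
      unfolding clique_def
    proof (intro conjI ballI impI)
      show "g ` I \<subseteq> verts G"
      proof
        fix x assume "x \<in> g ` I"
        then obtain i where "i \<in> I" "x = g i" by blast
        then show "x \<in> verts G" using a(1)[of i] by (cases "i \<in> D") (auto simp: g_def verts_eq)
      qed
      fix x y assume "x \<in> g ` I" "y \<in> g ` I" "x \<noteq> y"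
      then obtain i j where ij: "i \<in> I" "j \<in> I" "x = g i" "y = g j" "i \<noteq> j" by blast
      then show "{x, y} \<in> edges G"
        using wing_wing[of i j] wing_orig[of i j] wing_orig[of j i] orig_orig_edge[of i j]
        by (cases "i \<in> D"; cases "j \<in> D") (auto simp: g_def insert_commute)
    qed
    moreover have "card (g ` I) = card I"
      by (rule card_image) (auto simp: inj_on_def g_def split: if_splits)
    ultimately show False using assms by fastforce
  qed
  then show thesis using that by (metis insertCI)
qed

text \<open>The class is closed under deleting all vertices of one index. The induction trades
  rounds of the operator against these deletions.\<close>

lemma stretched_clique_delete:
  assumes "j \<in> I"
  shows "stretched_clique_exact (I - {j}) (D - {j}) (induced G (verts G - part j))"
proof -
  have hubW: "x \<notin> part j" if "x \<in> part i" "i \<noteq> j" for i x using part_disjoint[OF that(2)] that(1) by blast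
  have origW: "Orig u \<in> verts G - part j" if "u \<in> I - D" "u \<noteq> j" for u
    using that hubW[of "Orig u" u] by (auto simp: verts_eq part_def)
  have wingW: "hub i \<in> verts G - part j" "wing i 1 \<in> verts G - part j" "wing i 2 \<in> verts G - part j"
    if "i \<in> D" "i \<noteq> j" for i
    using that hubW[of _ i] by (auto simp: verts_eq part_def)
  have wingW': "wing i a \<in> verts G - part j" if "i \<in> D" "i \<noteq> j" "a \<in> {1, 2}" for i a
    using wingW[OF that(1,2)] that(3) by auto
  show ?thesis
  proof unfold_locales
    show "finite (I - {j})" using finite_I by simp
    show "D - {j} \<subseteq> I - {j}" using D_subset by blast
    show "verts (induced G (verts G - part j)) = Orig ` (I - {j} - (D - {j})) \<union> hub ` (D - {j}) \<union>
        (\<lambda>i. wing i 1) ` (D - {j}) \<union> (\<lambda>i. wing i 2) ` (D - {j})"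
      by (auto simp: verts_eq part_def)
    show "\<exists>x y. x \<in> verts (induced G (verts G - part j)) \<and> y \<in> verts (induced G (verts G - part j)) \<and>
        x \<noteq> y \<and> e = {x, y}" if e: "e \<in> edges (induced G (verts G - part j))" for e
    proof -
      obtain x y where "x \<in> verts G" "y \<in> verts G" "x \<noteq> y" "e = {x, y}"
        using edgeE[of e] e unfolding edges_induced by blast
      then show ?thesis using e by auto
    qed
    show "{Orig u, Orig w} \<in> edges (induced G (verts G - part j))"
      if "u \<in> I - {j} - (D - {j})" "w \<in> I - {j} - (D - {j})" "u \<noteq> w" for u w
      using that orig_orig_edge[of u w] origW by auto
    show "{hub i, y} \<in> edges (induced G (verts G - part j)) \<longleftrightarrow> y = wing i 1 \<or> y = wing i 2"
      if "i \<in> D - {j}" for i y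
      using that hub_edge_iff[of i y] wingW[of i] by auto
    show "{wing i 1, wing i 2} \<notin> edges (induced G (verts G - part j))" if "i \<in> D - {j}" for i
      using that wings_nonadjacent by auto
    show "\<exists>a\<in>{1, 2}. {wing i a, Orig u} \<in> edges (induced G (verts G - part j))"
      if "i \<in> D - {j}" "u \<in> I - {j} - (D - {j})" for i u
      using that wing_orig_edge[of i u] origW[of u] wingW[of i] by auto
    show "\<exists>!p. p \<in> {1, 2} \<times> {1, 2} \<and> {wing i (fst p), wing k (snd p)} \<in> edges (induced G (verts G - part j))"
      if "i \<in> D - {j}" "k \<in> D - {j}" "i \<noteq> k" for i k
    proof -
      have "(p \<in> {1, 2} \<times> {1, 2} \<and> {wing i (fst p), wing k (snd p)} \<in> edges (induced G (verts G - part j))) \<longleftrightarrow>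
         (p \<in> {1, 2} \<times> {1, 2} \<and> {wing i (fst p), wing k (snd p)} \<in> edges G)" for p
        using that wingW'[of i "fst p"] wingW'[of k "snd p"] by auto
      then show ?thesis using wing_wing_edge[of i k] that by (simp only:) blast
    qed
  qed
qed

end

section \<open>Successive stretching preserves the adjacency rules\<close>

lemma complete_graph_stretched: "stretched_clique_base {1..n} {} (complete_graph n)"
proof -
  have "\<exists>x\<in>{1..n}. \<exists>y\<in>{1..n}. x \<noteq> y \<and> {Orig i, Orig j} = {Orig x, Orig y}"
    if "i \<in> {1..n}" "j \<in> {1..n}" "i \<noteq> j" for i j
    using that by blast
  then show ?thesis by unfold_locales (auto simp: complete_graph_def)
qed

lemma stretch_edges:
  "edges (stretch G (Orig i) [A, B]) = {e \<in> edges G. Orig i \<notin> e} \<union>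
     {{wing i 1, hub i}, {wing i 2, hub i}} \<union> (\<lambda>u. {wing i 1, u}) ` A \<union> (\<lambda>u. {wing i 2, u}) ` B"
proof -
  have "{{Sub (Orig i) j, Sub (Orig i) 0} | j. j \<in> {1..length [A, B]}} = {{wing i 1, hub i}, {wing i 2, hub i}}"
  proof -
    have "{1..length [A, B]} = {1, 2}" by auto
    then show ?thesis by auto
  qed
  moreover have "{{Sub (Orig i) j, u} | j u. j \<in> {1..length [A, B]} \<and> u \<in> [A, B] ! (j - 1)} =
      (\<lambda>u. {wing i 1, u}) ` A \<union> (\<lambda>u. {wing i 2, u}) ` B"
  proof -
    have "{1..length [A, B]} = {1, 2}" by auto
    then have "{{Sub (Orig i) j, u} | j u. j \<in> {1..length [A, B]} \<and> u \<in> [A, B] ! (j - 1)} =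
        (\<Union>j\<in>{1, 2}. (\<lambda>u. {wing i j, u}) ` ([A, B] ! (j - 1)))"
      by blast
    then show ?thesis by simp
  qed
  ultimately show ?thesis unfolding stretch_def by (simp only: graph.sel Un_assoc)
qed

lemma stretch_verts:
  "verts (stretch G (Orig i) [A, B]) = verts G - {Orig i} \<union> {hub i, wing i 1, wing i 2}"
proof -
  have "{Sub (Orig i) j | j. j \<le> length [A, B]} = {hub i, wing i 1, wing i 2}"
    by (auto simp: le_Suc_eq numeral_2_eq_2)
  then show ?thesis unfolding stretch_def by (simp only: graph.sel)
qed

text \<open>No hub is adjacent to \<open>Orig i\<close>, so \<open>A\<close> and \<open>B\<close>
  contain no earlier hub and the old hubs keep exactly two neighbours. Every remaining unstretched
  vertex is a neighbour of \<open>Orig i\<close>, hence adjacent to a new wing because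
  \<open>A\<close> and \<open>B\<close> cover the neighbourhood.\<close>

lemma (in stretched_clique_base) stretch_stretched:
  assumes i: "i \<in> I" "Orig i \<in> verts G" and AB: "A \<union> B = neighborhood G (Orig i)"
  shows "stretched_clique_base I (insert i D) (stretch G (Orig i) [A, B])" "i \<notin> D"
proof -
  show iD: "i \<notin> D" using i by (auto simp: verts_eq)
  have nb: "x \<in> A \<union> B \<longleftrightarrow> {x, Orig i} \<in> edges G" for x
    using AB edge_subset[of "{x, Orig i}"] by (auto simp: neighborhood_def)
  have AB_verts: "x \<in> verts G" "x \<noteq> Orig i" "x \<notin> hub ` D" "x \<noteq> hub i" "x \<noteq> wing i 1" "x \<noteq> wing i 2"
    if x: "x \<in> A \<union> B" for x
  proof -
    have e: "{x, Orig i} \<in> edges G" using nb x by blast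
    show xv: "x \<in> verts G" using edge_subset[OF e] by blast
    show "x \<noteq> Orig i" using e no_loop by auto
    show "x \<notin> hub ` D" using e hub_edge_iff by auto
    show "x \<noteq> hub i" "x \<noteq> wing i 1" "x \<noteq> wing i 2" using xv iD by (auto simp: verts_eq)
  qed
  have notAB: "hub i \<notin> A" "hub i \<notin> B" "wing i 1 \<notin> A" "wing i 1 \<notin> B" "wing i 2 \<notin> A" "wing i 2 \<notin> B"
    using AB_verts by blast+
  have new: "hub i \<notin> verts G" "wing i 1 \<notin> verts G" "wing i 2 \<notin> verts G"
    using iD by (auto simp: verts_eq)
  have Orig_in: "Orig u \<in> A \<or> Orig u \<in> B" if "u \<in> I - D" "u \<noteq> i" for u
    using orig_orig_edge[of u i] nb[of "Orig u"] that i(1) iD by auto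
  let ?H = "stretch G (Orig i) [A, B]"
  show "stretched_clique_base I (insert i D) ?H"
  proof unfold_locales
    show "finite I" by (rule finite_I)
    show "insert i D \<subseteq> I" using i(1) D_subset by blast
    show "verts ?H = Orig ` (I - insert i D) \<union> hub ` insert i D \<union>
        (\<lambda>i. wing i 1) ` insert i D \<union> (\<lambda>i. wing i 2) ` insert i D"
      unfolding stretch_verts using iD by (auto simp: verts_eq)
    show "\<exists>x y. x \<in> verts ?H \<and> y \<in> verts ?H \<and> x \<noteq> y \<and> e = {x, y}" if e: "e \<in> edges ?H" for e
    proof -
      have *: ?thesis if "e = {wing i a, u}" "a \<in> {1, 2}" "u \<in> A \<union> B" for a u
        using AB_verts[OF that(3)] that(1,2) unfolding stretch_verts by blast
      consider "e \<in> edges G" "Orig i \<notin> e" | "e = {wing i 1, hub i}" | "e = {wing i 2, hub i}"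
        | u where "u \<in> A" "e = {wing i 1, u}" | u where "u \<in> B" "e = {wing i 2, u}"
        using e unfolding stretch_edges by blast
      then show ?thesis
      proof cases
        case 1
        then show ?thesis using edgeE[of e] unfolding stretch_verts by blast
      next
        case 2
        then show ?thesis unfolding stretch_verts by (intro exI[of _ "wing i 1"] exI[of _ "hub i"]) auto
      next
        case 3
        then show ?thesis unfolding stretch_verts by (intro exI[of _ "wing i 2"] exI[of _ "hub i"]) auto
      next
        case 4
        then show ?thesis using *[of 1] by blast
      next
        case 5
        then show ?thesis using *[of 2] by blast
      qed
    qed
    show "{Orig u, Orig w} \<in> edges ?H" if "u \<in> I - insert i D" "w \<in> I - insert i D" "u \<noteq> w" for u w
      using that orig_orig_edge[of u w] unfolding stretch_edges by auto
    show "{hub k, y} \<in> edges ?H \<longleftrightarrow> y = wing k 1 \<or> y = wing k 2" if k: "k \<in> insert i D" for k y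
    proof (cases "k = i")
      case True
      have "{hub i, y} \<notin> edges G" using edge_subset new by blast
      then show ?thesis
        using True notAB unfolding stretch_edges by (auto simp: doubleton_eq_iff)
    next
      case False
      then have kD: "k \<in> D" using k by simp
      have "Orig i \<noteq> y" if "{hub k, y} \<in> edges G" using that hub_edge_iff[OF kD, of y] by auto
      moreover have "hub k \<notin> A" "hub k \<notin> B" using AB_verts(3) kD by blast+
      ultimately show ?thesis using False hub_edge_iff[OF kD, of y]
        unfolding stretch_edges by (auto simp: doubleton_eq_iff)
    qed
    show "{wing k 1, wing k 2} \<notin> edges ?H" if "k \<in> insert i D" for k
    proof (cases "k = i")
      case True
      have "{wing i 1, wing i 2} \<notin> edges G" using edge_subset new by blast
      moreover have "{wing i 1, wing i 2} \<noteq> {wing i 1, u}" if "u \<in> A" for u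
        using that notAB(5) by (metis doubleton_eq_iff)
      moreover have "{wing i 1, wing i 2} \<noteq> {wing i 2, u}" if "u \<in> B" for u
        using that notAB(4) by (metis doubleton_eq_iff)
      moreover have "{wing i 1, wing i 2} \<noteq> {wing i 1, hub i}" "{wing i 1, wing i 2} \<noteq> {wing i 2, hub i}"
        by (simp_all add: doubleton_eq_iff)
      ultimately show ?thesis unfolding stretch_edges True by blast
    next
      case False
      then have "wing i 1 \<notin> {wing k 1, wing k 2}" "wing i 2 \<notin> {wing k 1, wing k 2}" by simp_all
      then have "{wing k 1, wing k 2} \<noteq> {wing i 1, u}" "{wing k 1, wing k 2} \<noteq> {wing i 2, u}" for u
        by (metis insertI1)+
      then show ?thesis using that wings_nonadjacent[of k] False unfolding stretch_edges by blast
    qed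
    show "\<exists>a\<in>{1, 2}. {wing k a, Orig u} \<in> edges ?H"
      if k: "k \<in> insert i D" and u: "u \<in> I - insert i D" for k u
    proof (cases "k = i")
      case True
      then show ?thesis using Orig_in[of u] u unfolding stretch_edges by auto
    next
      case False
      then show ?thesis using wing_orig_edge[of k u] k u unfolding stretch_edges by auto
    qed
  qed
qed

lemma stretched_clique_imp_base:
  assumes "stretched_clique n d G"
  shows "\<exists>D. card D = d \<and> stretched_clique_base {1..n} D G"
  using assms
proof (induction rule: stretched_clique.induct)
  case base
  then show ?case using complete_graph_stretched by (metis card.empty)
next
  case (step d G i A B)
  then obtain D where D: "card D = d" "stretched_clique_base {1..n} D G" by blast
  interpret stretched_clique_base "{1..n}" D G by (rule D(2))
  have "card (insert i D) = Suc d"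
    using stretch_stretched(2)[OF step.hyps(2-)] D(1) finite_D by simp
  then show ?case using stretch_stretched(1)[OF step.hyps(2-)] by blast
qed

lemma stretched_clique_hat_imp_exact:
  assumes "stretched_clique_hat n d G"
  shows "\<exists>D. card D = d \<and> stretched_clique_exact {1..n} D G"
proof -
  obtain D where D: "card D = d" "stretched_clique_base {1..n} D G"
    using stretched_clique_imp_base[OF conjunct1[OF assms[unfolded stretched_clique_hat_def]]] by blast
  interpret stretched_clique_base "{1..n}" D G by (rule D(2))
  have "stretched_clique_exact {1..n} D G"
    using conjunct2[OF assms[unfolded stretched_clique_hat_def stretched_verts_eq], rule_format]
    by unfold_locales
  then show ?thesis using D(1) by blast
qed

section \<open>The certificate\<close>

definition char_vec :: "'a set \<Rightarrow> 'a option \<Rightarrow> real" where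
  "char_vec S = lift_vec 1 (indicat_real S)"

lemma char_vec_simps [simp]:
  "char_vec S None = 1" "char_vec S (Some v) = (if v \<in> S then 1 else 0)"
  by (simp_all add: char_vec_def indicator_def)

lemma unit_vec_simps [simp]:
  "unit_vec (Some x) None = 0" "unit_vec (Some x) (Some y) = (if x = y then 1 else 0)"
  by (auto simp: unit_vec_def)

lemma char_vec_insert: "x \<notin> S \<Longrightarrow> char_vec (insert x S) = char_vec S + unit_vec (Some x)"
proof
  fix r assume "x \<notin> S" then show "char_vec (insert x S) r = (char_vec S + unit_vec (Some x)) r"
    by (cases r) auto
qed

lemma char_vec_remove: "x \<in> S \<Longrightarrow> char_vec (S - {x}) = char_vec S - unit_vec (Some x)"
proof
  fix r assume "x \<in> S" then show "char_vec (S - {x}) r = (char_vec S - unit_vec (Some x)) r"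
    by (cases r) auto
qed

lemma stable_set_induced: "stable_set (induced G W) S \<longleftrightarrow> stable_set G S \<and> S \<subseteq> W"
proof -
  have "{u, v} \<subseteq> W" if "S \<subseteq> W" "u \<in> S" "v \<in> S" for u v using that by blast
  then show ?thesis unfolding stable_set_def by (simp only: verts_induced edges_induced) blast
qed

lemma add_fixed_char_vec: "add_fixed Z (char_vec S) = char_vec (S \<union> Z)"
proof
  fix r show "add_fixed Z (char_vec S) r = char_vec (S \<union> Z) r"
    by (cases r) (auto simp: add_fixed_def)
qed

lemma add_fixed_diff: "add_fixed Z (x - c *\<^sub>R y) = add_fixed Z x - c *\<^sub>R add_fixed Z y"
  unfolding add_fixed_eq by (intro ext) simp

lemma add_fixed_sum: "add_fixed Z (\<Sum>a\<in>A. f a) = (\<Sum>a\<in>A. add_fixed Z (f a))"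
  unfolding add_fixed_eq by (intro ext) (simp add: sum_fun_apply)

text \<open>
  On the kernel of the five squares all of \<open>p, q, r, U, W\<close> equal \<open>-\<beta>\<close>, and there the bracket is
  \<open>\<beta>\<^sup>2\<close>, which dominates the negative term.
\<close>

lemma five_squares_perturbed_nonneg:
  fixes \<beta> p q r U W \<eta> :: real
  assumes "0 \<le> \<eta>" "\<eta> \<le> 1 / 100"
  shows "0 \<le> (\<beta> + U)\<^sup>2 + (\<beta> + W)\<^sup>2 + (\<beta> - p + q + r)\<^sup>2 + (\<beta> + U - p + q)\<^sup>2 + (\<beta> + W - p + r)\<^sup>2
    - \<eta> * \<beta>\<^sup>2 + 2 * \<eta> * (p * U - U * q + q * r - r * W + W * p)"
proof -
  \<comment> \<open>The five squared terms become variables. With \<open>\<beta>\<close> they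
    determine everything else, since \<open>P\<close>, \<open>q'\<close>, \<open>r'\<close> equal
    \<open>p + \<beta>\<close>, \<open>q + \<beta>\<close>, \<open>r + \<beta>\<close>.\<close>
  define a1 a2 a3 a4 a5 where a: "a1 = \<beta> + U" "a2 = \<beta> + W" "a3 = \<beta> - p + q + r"
    "a4 = \<beta> + U - p + q" "a5 = \<beta> + W - p + r"
  define P q' r' where P: "P = a1 + a2 + a3 - a4 - a5" "q' = a2 + a3 - a5" "r' = a1 + a3 - a4"
  define R where "R = P * a1 - a1 * q' + q' * r' - r' * a2 + a2 * P"
  define N where "N = a1\<^sup>2 + a2\<^sup>2 + a3\<^sup>2 + a4\<^sup>2 + a5\<^sup>2"
  have sub: "U = a1 - \<beta>" "W = a2 - \<beta>" "p = P - \<beta>" "q = q' - \<beta>" "r = r' - \<beta>"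
    by (simp_all add: a P)
  \<comment> \<open>Shifting all five variables of the five-cycle form by \<open>\<beta>\<close>
    produces \<open>\<beta>\<^sup>2\<close>, since the signs sum to 1, and a linear term in
    \<open>P\<close> only, since at each of the other four variables the two incident signs
    cancel.\<close>
  have eq: "p * U - U * q + q * r - r * W + W * p = \<beta>\<^sup>2 - 2 * P * \<beta> + R"
    unfolding sub R_def by (simp add: algebra_simps power2_eq_square)
  have pm: "- (x\<^sup>2 + y\<^sup>2) \<le> 2 * (x * y)" "2 * (x * y) \<le> x\<^sup>2 + y\<^sup>2" for x y :: real
    using zero_le_power2[of "x + y"] zero_le_power2[of "x - y"]
    by (simp_all add: power2_sum power2_diff)
  have PN: "P\<^sup>2 \<le> 5 * N"
    unfolding P N_def
    using pm[of a1 a2] pm[of a1 a3] pm[of a1 a4] pm[of a1 a5] pm[of a2 a3] pm[of a2 a4] pm[of a2 a5]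
      pm[of a3 a4] pm[of a3 a5] pm[of a4 a5]
    by (simp add: algebra_simps power2_eq_square)
  have "q'\<^sup>2 \<le> 3 * (a2\<^sup>2 + a3\<^sup>2 + a5\<^sup>2)"
    unfolding P using pm[of a2 a3] pm[of a2 a5] pm[of a3 a5]
    by (simp add: algebra_simps power2_eq_square)
  also have "\<dots> \<le> 3 * N" by (simp add: N_def)
  finally have qN: "q'\<^sup>2 \<le> 3 * N" .
  have "r'\<^sup>2 \<le> 3 * (a1\<^sup>2 + a3\<^sup>2 + a4\<^sup>2)"
    unfolding P using pm[of a1 a3] pm[of a1 a4] pm[of a3 a4]
    by (simp add: algebra_simps power2_eq_square)
  also have "\<dots> \<le> 3 * N" by (simp add: N_def)
  finally have rN: "r'\<^sup>2 \<le> 3 * N" .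
  have aN: "a1\<^sup>2 \<le> N" "a2\<^sup>2 \<le> N" and N0: "0 \<le> N" by (simp_all add: N_def)
  have "- 2 * R \<le> 2 * P\<^sup>2 + 2 * q'\<^sup>2 + 2 * r'\<^sup>2 + 2 * a1\<^sup>2 + 2 * a2\<^sup>2"
    unfolding R_def using pm[of P a1] pm[of a1 q'] pm[of q' r'] pm[of r' a2] pm[of a2 P]
    by (simp add: algebra_simps)
  \<comment> \<open>Completing the square to \<open>(\<beta> - 2 * P)\<^sup>2\<close> leaves this
    term to be paid by \<open>N\<close>. The bounds add up to \<open>46 * N\<close>; the round
    number 100 matches the bound on \<open>\<eta>\<close>.\<close>
  then have "4 * P\<^sup>2 - 2 * R \<le> 100 * N" using PN qN rN aN N0 by linarith
  then have "\<eta> * (4 * P\<^sup>2 - 2 * R) \<le> \<eta> * (100 * N)" using assms(1) by (rule mult_left_mono)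
  also have "\<eta> * (100 * N) \<le> N" using mult_right_mono[OF assms(2) N0] by simp
  finally have "\<eta> * (4 * P\<^sup>2 - 2 * R) \<le> N" .
  moreover have "0 \<le> \<eta> * (\<beta> - 2 * P)\<^sup>2" using assms(1) by simp
  ultimately have "0 \<le> N - \<eta> * \<beta>\<^sup>2 + 2 * \<eta> * (\<beta>\<^sup>2 - 2 * P * \<beta> + R)"
    by (simp add: algebra_simps power2_eq_square)
  then show ?thesis unfolding eq N_def a .
qed

section \<open>Maximum stable sets, their partial sums, and deletion of an index\<close>

context stretched_clique_exact
begin

abbreviation "hubs_vec \<equiv> char_vec (hubs G)"

definition max_stable :: "vertex set set" where
  "max_stable = {S. stable_set G S \<and> card S = card D + 1}"

text \<open>With \<open>Q\<close> the condition \<open>v \<in> S\<close>, this is column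
  \<open>v\<close> of the unperturbed certificate.\<close>

definition sum_over :: "(vertex set \<Rightarrow> bool) \<Rightarrow> vertex option \<Rightarrow> real" where
  "sum_over Q = (\<Sum>S | S \<in> max_stable \<and> Q S. char_vec S)"

lemma finite_max_stable: "finite max_stable"
proof -
  have "max_stable \<subseteq> Pow (verts G)" by (auto simp: max_stable_def stable_set_def)
  then show ?thesis using finite_verts finite_subset by blast
qed

lemma v_vec_eq: "v_vec (card D) G \<epsilon> = sum_over (\<lambda>S. True) - \<epsilon> *\<^sub>R hubs_vec"
  by (simp add: v_vec_def sum_over_def max_stable_def char_vec_def)

lemma sum_over_split:
  "sum_over Q = sum_over (\<lambda>S. Q S \<and> R S) + sum_over (\<lambda>S. Q S \<and> \<not> R S)"
proof -
  have "{S \<in> max_stable. Q S} = {S \<in> max_stable. Q S \<and> R S} \<union> {S \<in> max_stable. Q S \<and> \<not> R S}" by blast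
  then show ?thesis unfolding sum_over_def
    using finite_max_stable by (simp only:) (intro sum.union_disjoint, auto)
qed

lemma sum_over_cong: "(\<And>S. S \<in> max_stable \<Longrightarrow> Q S = R S) \<Longrightarrow> sum_over Q = sum_over R"
  unfolding sum_over_def by (intro sum.cong) auto

lemma top_set_max_stable: "i \<in> I \<Longrightarrow> top_set i \<in> max_stable"
  by (simp add: max_stable_def top_set_stable card_top_set)

lemma swap_set_max_stable: "i \<in> D \<Longrightarrow> a \<in> {1, 2} \<Longrightarrow> far i a u \<Longrightarrow> swap_set i a u \<in> max_stable"
  unfolding max_stable_def using swap_set_stable card_swap_set by blast

lemma max_stable_edge: "S \<in> max_stable \<Longrightarrow> {x, y} \<in> edges G \<Longrightarrow> x \<in> S \<Longrightarrow> y \<notin> S"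
  by (auto simp: max_stable_def stable_set_def)

lemma wing_notin_if_hub:
  "S \<in> max_stable \<Longrightarrow> i \<in> D \<Longrightarrow> hub i \<in> S \<Longrightarrow> a \<in> {1, 2} \<Longrightarrow> wing i a \<notin> S"
  using max_stable_edge[of S "hub i" "wing i a"] hub_edge_iff[of i "wing i a"] by blast

lemma part_neq: "i \<noteq> j \<Longrightarrow> x \<in> part i \<Longrightarrow> x \<notin> part j"
  using part_disjoint by blast

lemma top_set_part:
  assumes "v \<in> part j" "v \<notin> hubs G"
  shows "v \<in> top_set i \<longleftrightarrow> i = j"
  using assms by (auto simp: part_def top_set_def hubs_eq split: if_splits)

text \<open>Base case of the induction. The coordinates count maximum stable sets, lowered by 1/2 at
  \<open>None\<close> and at hubs. Where the lowering at \<open>None\<close> is not matched by one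
  at a hub, some maximum stable set misses the vertices concerned and makes up for it.\<close>

lemma v_vec_FRAC:
  assumes "card I \<ge> 3"
  shows "v_vec (card D) G (1 / 2) \<in> lift_cone (FRAC G)"
proof -
  let ?v = "v_vec (card D) G (1 / 2)"
  define cnt where "cnt = (\<lambda>Q. real (card {S \<in> max_stable. Q S}))"
  have v0: "?v None = cnt (\<lambda>S. True) - 1 / 2"
    by (simp add: v_vec_eq sum_over_def sum_fun_apply cnt_def)
  have vv: "?v (Some x) = cnt (\<lambda>S. x \<in> S) - (if x \<in> hubs G then 1 / 2 else 0)" for x
    using finite_max_stable
    by (simp add: v_vec_eq sum_over_def sum_fun_apply cnt_def sum.If_cases Int_def)
  have fin: "finite {S \<in> max_stable. Q S}" for Q using finite_max_stable by simp
  have cnt_ge1: "cnt Q \<ge> 1" if "S \<in> max_stable" "Q S" for S Q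
  proof -
    have "card {S \<in> max_stable. Q S} \<noteq> 0" using fin that by auto
    then show ?thesis by (simp add: cnt_def)
  qed
  have cnt_split: "cnt Q = cnt (\<lambda>S. Q S \<and> R S) + cnt (\<lambda>S. Q S \<and> \<not> R S)" for Q R
  proof -
    have "card ({S \<in> max_stable. Q S \<and> R S} \<union> {S \<in> max_stable. Q S \<and> \<not> R S}) =
       card {S \<in> max_stable. Q S \<and> R S} + card {S \<in> max_stable. Q S \<and> \<not> R S}"
      by (rule card_Un_disjoint) (use fin in auto)
    moreover have "{S \<in> max_stable. Q S \<and> R S} \<union> {S \<in> max_stable. Q S \<and> \<not> R S} = {S \<in> max_stable. Q S}"
      by blast
    ultimately show ?thesis by (simp add: cnt_def)
  qed
  have cnt0: "0 \<le> cnt Q" for Q by (simp add: cnt_def)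
  \<comment> \<open>Besides the two indices of an edge there is a third one; its
    \<open>top_set\<close> meets the parts of those two only in hubs.\<close>
  have other: "\<exists>w\<in>I. w \<noteq> i \<and> w \<noteq> j" for i j
  proof (rule ccontr)
    assume "\<not> ?thesis"
    then have "card I \<le> card {i, j}" by (intro card_mono) auto
    also have "\<dots> \<le> 2" by (simp add: card_insert_if)
    finally show False using assms by simp
  qed
  have pos: "?v None > 0"
  proof -
    obtain w where "w \<in> I" using other by blast
    then show ?thesis using v0 cnt_ge1[OF top_set_max_stable, of w "\<lambda>S. True"] by simp
  qed
  have ge0: "0 \<le> ?v (Some x)" for x
  proof (cases "x \<in> hubs G")
    case True
    then obtain i where i: "i \<in> D" "x = hub i" by (auto simp: hubs_eq)
    obtain w where "w \<in> I" "w \<noteq> i" using other by blast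
    then show ?thesis
      using True i vv[of x] cnt_ge1[OF top_set_max_stable, of w "\<lambda>S. x \<in> S"] by (simp add: hub_in_top_set)
  qed (simp add: vv cnt0)
  have le1: "?v (Some x) \<le> ?v None" if x: "x \<in> verts G" for x
  proof (cases "x \<in> hubs G")
    case True
    then show ?thesis using vv[of x] v0 cnt_split[of "\<lambda>S. True" "\<lambda>S. x \<in> S"] cnt0[of "\<lambda>S. x \<notin> S"] by simp
  next
    case False
    obtain i where i: "x \<in> part i" using x verts_parts by blast
    obtain w where "w \<in> I" "w \<noteq> i" using other by blast
    then have "cnt (\<lambda>S. x \<notin> S) \<ge> 1"
      using cnt_ge1[OF top_set_max_stable, of w "\<lambda>S. x \<notin> S"] top_set_part[OF i False, of w] by simp
    then show ?thesis using False vv[of x] v0 cnt_split[of "\<lambda>S. True" "\<lambda>S. x \<in> S"] by simp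
  qed
  have edge: "?v (Some x) + ?v (Some y) \<le> ?v None" if e: "{x, y} \<in> edges G" for x y
  proof -
    have xy: "x \<in> verts G" "y \<in> verts G" using edge_subset[OF e] by auto
    have "cnt (\<lambda>S. x \<notin> S \<and> y \<in> S) = cnt (\<lambda>S. y \<in> S)"
      unfolding cnt_def using max_stable_edge[OF _ e]
      by (intro arg_cong[where f = real] arg_cong[where f = card]) blast
    then have tot: "cnt (\<lambda>S. True) = cnt (\<lambda>S. x \<in> S) + cnt (\<lambda>S. y \<in> S) + cnt (\<lambda>S. x \<notin> S \<and> y \<notin> S)"
      using cnt_split[of "\<lambda>S. True" "\<lambda>S. x \<in> S"] cnt_split[of "\<lambda>S. x \<notin> S" "\<lambda>S. y \<in> S"] by simp
    show ?thesis
    proof (cases "x \<in> hubs G \<or> y \<in> hubs G")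
      case True
      then show ?thesis using tot vv[of x] vv[of y] v0 cnt0[of "\<lambda>S. x \<notin> S \<and> y \<notin> S"] by auto
    next
      case False
      obtain i j where ij: "x \<in> part i" "y \<in> part j" using xy verts_parts by blast
      obtain w where "w \<in> I" "w \<noteq> i" "w \<noteq> j" using other by blast
      then have "cnt (\<lambda>S. x \<notin> S \<and> y \<notin> S) \<ge> 1"
        using cnt_ge1[OF top_set_max_stable, of w "\<lambda>S. x \<notin> S \<and> y \<notin> S"] False
          top_set_part[OF ij(1), of w] top_set_part[OF ij(2), of w] by simp
      then show ?thesis using tot vv[of x] vv[of y] v0 False by simp
    qed
  qed
  have out: "?v (Some x) = 0" if "x \<notin> verts G" for x
  proof -
    have "{S \<in> max_stable. x \<in> S} = {}" using that by (auto simp: max_stable_def stable_set_def)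
    then have "cnt (\<lambda>S. x \<in> S) = 0" unfolding cnt_def by (simp only: card.empty of_nat_0)
    moreover have "x \<notin> hubs G" using that hubs_subset by blast
    ultimately show ?thesis by (simp add: vv)
  qed
  define y where "y = (\<lambda>x. ?v (Some x) / ?v None)"
  have "y \<in> FRAC G"
    using pos ge0 le1 edge out
    by (auto simp: FRAC_def fun_power_def y_def divide_simps simp flip: add_divide_distrib)
  moreover have "?v = lift_vec (?v None) (?v None *\<^sub>R y)"
    using pos by (intro lift_vec_eqI) (simp_all add: y_def)
  ultimately show ?thesis using lift_coneI[of "?v None" y "FRAC G"] pos by simp
qed

text \<open>Inserting \<open>hub j\<close> maps the maximum stable sets of the graph without
  \<open>part j\<close> bijectively onto those of \<open>G\<close> that contain
  \<open>hub j\<close>. So the vector of the smaller graph, with \<open>hub j\<close> fixed to 1, is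
  this difference.\<close>

lemma v_vec_delete_stretched:
  assumes j: "j \<in> D" and I: "I \<noteq> {j}"
    and v: "v_vec (card (D - {j})) (induced G (verts G - part j)) \<epsilon>
      \<in> lift_cone (LS_plus_graph m (induced G (verts G - part j)))"
  shows "sum_over (\<lambda>S. hub j \<in> S) - \<epsilon> *\<^sub>R hubs_vec \<in> lift_cone (LS_plus_graph m G)"
proof -
  let ?W = "verts G - part j" and ?Z = "{hub j}"
  have jI: "j \<in> I" using j D_subset by blast
  interpret H: stretched_clique_exact "I - {j}" "D - {j}" "induced G ?W"
    by (rule stretched_clique_delete[OF jI])
  have hj: "hub j \<in> verts G" "hub j \<notin> ?W" using j by (auto simp: verts_eq part_def)
  have cd: "card D = Suc (card (D - {j}))" using j finite_D by (metis card_Suc_Diff1)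
  have stable_iff: "stable_set (induced G ?W) S \<longleftrightarrow> stable_set G (insert (hub j) S) \<and> hub j \<notin> S" for S
  proof
    assume S: "stable_set (induced G ?W) S"
    then have SW: "S \<subseteq> ?W" and "stable_set G S" by (auto simp: stable_set_induced)
    moreover have "{hub j, s} \<notin> edges G" if "s \<in> S" for s
      using SW that j by (auto simp: hub_edge_iff part_def)
    ultimately show "stable_set G (insert (hub j) S) \<and> hub j \<notin> S"
      using hj SW by (auto intro!: stable_insert)
  next
    assume S: "stable_set G (insert (hub j) S) \<and> hub j \<notin> S"
    have "wing j 1 \<notin> S" "wing j 2 \<notin> S"
      using S hub_edge_iff[OF j] by (auto simp: stable_set_def)
    then have "S \<subseteq> ?W" using S j by (auto simp: stable_set_def part_def)
    then show "stable_set (induced G ?W) S"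
      using S stable_set_subset[of G "insert (hub j) S" S] by (auto simp: stable_set_induced)
  qed
  have card_iff: "card S = card (D - {j}) + 1 \<longleftrightarrow> card (insert (hub j) S) = card D + 1"
    if "stable_set (induced G ?W) S" for S
  proof -
    have "S \<subseteq> verts G" using that by (auto simp: stable_set_induced)
    then have "finite S" using finite_verts finite_subset by blast
    moreover have "hub j \<notin> S" using that stable_iff by blast
    ultimately show ?thesis using cd by simp
  qed
  have "bij_betw (insert (hub j)) H.max_stable {S \<in> max_stable. hub j \<in> S}"
    unfolding bij_betw_def
  proof
    show "inj_on (insert (hub j)) H.max_stable"
      unfolding inj_on_def H.max_stable_def using stable_iff by (auto simp: insert_ident)
    show "insert (hub j) ` H.max_stable = {S \<in> max_stable. hub j \<in> S}"
    proof
      show "insert (hub j) ` H.max_stable \<subseteq> {S \<in> max_stable. hub j \<in> S}"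
        unfolding H.max_stable_def max_stable_def using stable_iff card_iff by auto
      show "{S \<in> max_stable. hub j \<in> S} \<subseteq> insert (hub j) ` H.max_stable"
      proof
        fix S assume "S \<in> {S \<in> max_stable. hub j \<in> S}"
        then have S: "stable_set G S" "card S = card D + 1" "hub j \<in> S" by (auto simp: max_stable_def)
        have eq: "insert (hub j) (S - {hub j}) = S" using S by auto
        then have "stable_set (induced G ?W) (S - {hub j})" using S by (simp add: stable_iff)
        then have "S - {hub j} \<in> H.max_stable"
          using card_iff[of "S - {hub j}"] S eq by (simp add: H.max_stable_def)
        then show "S \<in> insert (hub j) ` H.max_stable" using eq by blast
      qed
    qed
  qed
  then have "(\<Sum>S\<in>H.max_stable. char_vec (insert (hub j) S)) = sum_over (\<lambda>S. hub j \<in> S)"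
    unfolding sum_over_def by (rule sum.reindex_bij_betw)
  moreover have "insert (hub j) (hubs (induced G ?W)) = hubs G"
    using j by (auto simp: H.hubs_eq hubs_eq)
  ultimately have eq: "add_fixed ?Z (v_vec (card (D - {j})) (induced G ?W) \<epsilon>) =
      sum_over (\<lambda>S. hub j \<in> S) - \<epsilon> *\<^sub>R hubs_vec"
    unfolding H.v_vec_eq H.sum_over_def add_fixed_diff add_fixed_sum add_fixed_char_vec by simp
  have "add_fixed ?Z (v_vec (card (D - {j})) (induced G ?W) \<epsilon>) \<in> lift_cone (LS_plus_graph m G)"
  proof (rule add_fixed_lift_cone[OF _ v])
    fix x assume "x \<in> LS_plus_graph m (induced G ?W)"
    then show "(\<lambda>v. if v \<in> ?Z then 1 else x v) \<in> LS_plus_graph m G"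
    proof (rule LS_plus_graph_induced_fix[rotated -1])
      obtain k where k: "k \<in> I" "k \<noteq> j" using I jI by blast
      have "part k \<noteq> {}" by (simp add: part_def)
      then show "?W \<noteq> {}" using part_subset[OF k(1)] part_disjoint[OF k(2)] by blast
      show "stable_set G ?Z" using hj no_loop by (auto simp: stable_set_def)
      show "{w, z} \<notin> edges G" if "w \<in> ?W" "z \<in> ?Z" for w z
        using that j by (auto simp: hub_edge_iff' part_def)
    qed (use finite_verts hj edge_subset in auto)
  qed
  then show ?thesis unfolding eq .
qed

text \<open>Here \<open>D\<close> is unchanged, so the maximum stable sets of the smaller graph are
  those of \<open>G\<close> that avoid \<open>Orig j\<close>, and no coordinate is fixed to
  1.\<close>

lemma v_vec_delete_unstretched:
  assumes j: "j \<in> I - D" and I: "I \<noteq> {j}"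
    and v: "v_vec (card (D - {j})) (induced G (verts G - part j)) \<epsilon>
      \<in> lift_cone (LS_plus_graph m (induced G (verts G - part j)))"
  shows "sum_over (\<lambda>S. Orig j \<notin> S) - \<epsilon> *\<^sub>R hubs_vec \<in> lift_cone (LS_plus_graph m G)"
proof -
  let ?W = "verts G - part j"
  have jI: "j \<in> I" using j by blast
  have Dj: "D - {j} = D" using j by blast
  interpret H: stretched_clique_exact "I - {j}" "D - {j}" "induced G ?W"
    by (rule stretched_clique_delete[OF jI])
  have stable_iff: "stable_set (induced G ?W) S \<longleftrightarrow> stable_set G S \<and> Orig j \<notin> S" for S
    unfolding stable_set_induced using j by (auto simp: stable_set_def part_def)
  have max_eq: "H.max_stable = {S \<in> max_stable. Orig j \<notin> S}"
    unfolding H.max_stable_def unfolding max_stable_def Dj stable_iff by blast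
  have eq: "v_vec (card (D - {j})) (induced G ?W) \<epsilon> = sum_over (\<lambda>S. Orig j \<notin> S) - \<epsilon> *\<^sub>R hubs_vec"
    unfolding H.v_vec_eq unfolding H.sum_over_def H.hubs_eq max_eq unfolding sum_over_def hubs_eq Dj
    by simp
  have "LS_plus_graph m (induced G ?W) \<subseteq> LS_plus_graph m G"
  proof
    fix x assume "x \<in> LS_plus_graph m (induced G ?W)"
    then have "(\<lambda>v. if v \<in> {} then 1 else x v) \<in> LS_plus_graph m G"
    proof (rule LS_plus_graph_induced_fix[rotated -1])
      obtain k where k: "k \<in> I" "k \<noteq> j" using I jI by blast
      have "part k \<noteq> {}" by (simp add: part_def)
      then show "?W \<noteq> {}" using part_subset[OF k(1)] part_disjoint[OF k(2)] by blast
      show "stable_set G {}" by (simp add: stable_set_def)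
    qed (use finite_verts edge_subset in auto)
    then show "x \<in> LS_plus_graph m G" by simp
  qed
  then show ?thesis using v lift_cone_mono unfolding eq by blast
qed

section \<open>One round: the five-cycle certificate\<close>

text \<open>The assumptions \<open>hub_good\<close> and \<open>orig_good\<close> are what the
  deletion lemmas provide. Each column and each complement is written as a partial sum, minus small
  multiples of \<open>hubs_vec\<close> and of its own members, plus stable sets.\<close>

lemma LS_plus_step:
  assumes P: "convex P" "\<And>S. stable_set G S \<Longrightarrow> indicat_real S \<in> P"
    and \<epsilon>0: "0 < \<epsilon>0" "\<epsilon>0 \<le> 1"
    and hub_good: "\<And>j. j \<in> D \<Longrightarrow> sum_over (\<lambda>S. hub j \<in> S) - \<epsilon>0 *\<^sub>R hubs_vec \<in> lift_cone P"
    and orig_good: "\<And>j. j \<in> I - D \<Longrightarrow> sum_over (\<lambda>S. Orig j \<notin> S) - \<epsilon>0 *\<^sub>R hubs_vec \<in> lift_cone P"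
    and cliques: "\<And>C. clique G C \<Longrightarrow> card C < card I"
  shows "\<exists>\<epsilon>>0. v_vec (card D) G \<epsilon> \<in> lift_cone (LS_plus (verts G) P)"
proof -
  let ?K = "lift_cone P" and ?b = hubs_vec
  have P_ne: "P \<noteq> {}" using P(2)[OF stable_hubs] by blast
  note add = lift_cone_add[OF P(1)]
  have char_K: "char_vec S \<in> ?K" if "stable_set G S" for S
    using P(2)[OF that] by (simp add: char_vec_def)
  have max_K: "char_vec S \<in> ?K" if "S \<in> max_stable" for S
    using char_K that by (simp add: max_stable_def)
  have sum_K: "sum_over Q \<in> ?K" for Q
    unfolding sum_over_def using max_K by (intro lift_cone_sum P(1) P_ne) auto
  have b_K: "?b \<in> ?K" by (rule char_K[OF stable_hubs])
  have plus_K: "x + t *\<^sub>R char_vec S \<in> ?K" if "x \<in> ?K" "stable_set G S" "0 \<le> t" for x t S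
    using add[OF that(1) lift_cone_scaleR[OF char_K[OF that(2)] that(3)]] .

  \<comment> \<open>A good family can pay for \<open>\<epsilon>0\<close> copies of
    \<open>hubs_vec\<close>, which need not be a member; \<open>remove\<close> below pays for
    members of the family.\<close>
  define good where "good Q \<longleftrightarrow> sum_over Q - \<epsilon>0 *\<^sub>R ?b \<in> ?K" for Q
  have good_le: "sum_over Q - t *\<^sub>R ?b \<in> ?K" if "good Q" "t \<le> \<epsilon>0" for Q t
  proof -
    have "sum_over Q - t *\<^sub>R ?b = (sum_over Q - \<epsilon>0 *\<^sub>R ?b) + (\<epsilon>0 - t) *\<^sub>R ?b"
      by (intro ext) (simp add: algebra_simps)
    also have "\<dots> \<in> ?K" using that by (intro plus_K stable_hubs) (auto simp: good_def)
    finally show ?thesis .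
  qed
  have good_mono: "good Q" if "good R" "\<And>S. S \<in> max_stable \<Longrightarrow> R S \<Longrightarrow> Q S" for Q R
  proof -
    have "sum_over Q = sum_over (\<lambda>S. Q S \<and> R S) + sum_over (\<lambda>S. Q S \<and> \<not> R S)" by (rule sum_over_split)
    also have "sum_over (\<lambda>S. Q S \<and> R S) = sum_over R" by (rule sum_over_cong) (use that(2) in blast)
    finally have "sum_over Q - \<epsilon>0 *\<^sub>R ?b = (sum_over R - \<epsilon>0 *\<^sub>R ?b) + sum_over (\<lambda>S. Q S \<and> \<not> R S)"
      by (intro ext) (simp add: algebra_simps)
    also have "\<dots> \<in> ?K" using that(1) by (intro add sum_K) (simp add: good_def)
    finally show ?thesis by (simp add: good_def)
  qed
  have remove: "sum_over Q - t *\<^sub>R char_vec R \<in> ?K" if R: "R \<in> max_stable" "Q R" "t \<le> 1" for Q R t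
  proof -
    have "sum_over Q = sum_over (\<lambda>S. Q S \<and> S = R) + sum_over (\<lambda>S. Q S \<and> S \<noteq> R)" by (rule sum_over_split)
    also have "sum_over (\<lambda>S. Q S \<and> S = R) = char_vec R"
    proof -
      have "{S \<in> max_stable. Q S \<and> S = R} = {R}" using R by blast
      then show ?thesis unfolding sum_over_def by simp
    qed
    finally have "sum_over Q - t *\<^sub>R char_vec R = sum_over (\<lambda>S. Q S \<and> S \<noteq> R) + (1 - t) *\<^sub>R char_vec R"
      by (intro ext) (simp add: algebra_simps)
    also have "\<dots> \<in> ?K" using R by (intro plus_K sum_K) (auto simp: max_stable_def)
    finally show ?thesis .
  qed
  \<comment> \<open>Averaging lets one partial sum pay for two subtractions, each from one half at
    twice the rate. This is the source of the bounds \<open>2 * s \<le> \<epsilon>0\<close> and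
    \<open>t \<le> 1 / 2\<close>.\<close>
  have half: "x \<in> ?K" if "y \<in> ?K" "z \<in> ?K" "\<And>r. x r = y r / 2 + z r / 2" for x y z
  proof -
    have "x = (1 / 2) *\<^sub>R y + (1 / 2) *\<^sub>R z" using that(3) by (intro ext) simp
    also have "\<dots> \<in> ?K" using that(1,2) by (intro add lift_cone_scaleR) auto
    finally show ?thesis .
  qed
  have remove2: "sum_over Q - t *\<^sub>R char_vec R - t *\<^sub>R char_vec R' \<in> ?K"
    if "R \<in> max_stable" "Q R" "R' \<in> max_stable" "Q R'" "t \<le> 1 / 2" for Q R R' t
    using that by (intro half[OF remove[of R Q "2 * t"] remove[of R' Q "2 * t"]]) (auto simp: field_simps)
  have good_remove: "sum_over Q - s *\<^sub>R ?b - t *\<^sub>R char_vec R \<in> ?K"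
    if "good Q" "R \<in> max_stable" "Q R" "2 * s \<le> \<epsilon>0" "t \<le> 1 / 2" for Q R s t
    using that by (intro half[OF good_le[of Q "2 * s"] remove[of R Q "2 * t"]]) (auto simp: field_simps)
  have good_hub: "good (\<lambda>S. hub j \<in> S)" if "j \<in> D" for j using hub_good that by (simp add: good_def)
  \<comment> \<open>The sets that contain a hub avoid its wings, so wings inherit goodness from
    \<open>good_hub\<close>; unstretched vertices use \<open>orig_good\<close>.\<close>
  have good_notin: "good (\<lambda>S. v \<notin> S)" if v: "v \<in> part j" "v \<notin> hubs G" "j \<in> I" for v j
  proof (cases "j \<in> D")
    case True
    then have "\<exists>a\<in>{1, 2}. v = wing j a" using v by (auto simp: part_def hubs_eq)
    then show ?thesis using True wing_notin_if_hub by (intro good_mono[OF good_hub[OF True]]) blast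
  next
    case False
    then show ?thesis using orig_good v by (simp add: good_def part_def)
  qed

  \<comment> \<open>\<open>ext_col i a u a' w s\<close> is column \<open>s\<close> of the five-cycle matrix \<open>E\<close>; it is invariant under exchanging
    \<open>(a, u)\<close> with \<open>(a', w)\<close>, which halves the case analysis below.\<close>
  define ext_col where "ext_col i a u a' w s =
     unit_vec (Some (hub i)) s *\<^sub>R ((char_vec (top_set u) - ?b) + (char_vec (top_set w) - ?b)) +
     unit_vec (Some (wing i a)) s *\<^sub>R (unit_vec (Some (wing i a')) - (char_vec (top_set u) - ?b)) +
     unit_vec (Some (wing i a')) s *\<^sub>R (unit_vec (Some (wing i a)) - (char_vec (top_set w) - ?b)) +
     (char_vec (top_set u) s - ?b s) *\<^sub>R (unit_vec (Some (hub i)) - unit_vec (Some (wing i a))) +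
     (char_vec (top_set w) s - ?b s) *\<^sub>R (unit_vec (Some (hub i)) - unit_vec (Some (wing i a')))"
    for i a u a' w s
  have swap: "ext_col i a u a' w s = ext_col i a' w a u s" for i a u a' w s
    unfolding ext_col_def by (intro ext) (simp add: algebra_simps)

  \<comment> \<open>The factor 1/100 comes from \<open>five_squares_perturbed_nonneg\<close>. The
    families below are charged up to \<open>3 * \<eta>\<close> copies of \<open>hubs_vec\<close>
    directly, or \<open>2 * \<eta>\<close> from one half, and both stay within
    \<open>\<epsilon>0\<close>.\<close>
  define \<eta> where "\<eta> = \<epsilon>0 / 100"
  have \<eta>: "0 < \<eta>" "\<eta> \<le> 1 / 100" "6 * \<eta> \<le> \<epsilon>0" using \<epsilon>0 by (auto simp: \<eta>_def)
  define col where "col i a u a' w v =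
    sum_over (\<lambda>S. v \<in> S) - (\<eta> * ?b (Some v)) *\<^sub>R ?b + \<eta> *\<^sub>R ext_col i a u a' w (Some v)" for i a u a' w v
  \<comment> \<open>Complement of \<open>col\<close>: column \<open>None\<close> of the certificate
    carries \<open>\<eta>\<close> copies of \<open>hubs_vec\<close> and no five-cycle part, hence
    the factor and the minus sign.\<close>
  define cocol where "cocol i a u a' w v =
    sum_over (\<lambda>S. v \<notin> S) - (\<eta> * (1 - ?b (Some v))) *\<^sub>R ?b - \<eta> *\<^sub>R ext_col i a u a' w (Some v)" for i a u a' w v

  \<comment> \<open>In every case the subtracted sets are \<open>hubs_vec\<close>, paid by a good
    family, and swap sets that belong to the family summed over.\<close>
  have cols: "col i a u a' w v \<in> ?K \<and> cocol i a u a' w v \<in> ?K"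
    if i: "i \<in> D" and aa: "a = 1 \<and> a' = 2 \<or> a = 2 \<and> a' = 1" and fu: "far i a u" and fw: "far i a' w"
      and uw: "u \<noteq> w" and v: "v = hub i \<or> v = wing i a \<or> v \<in> part u"
    for i a u a' w v
  proof -
    define p q r where pqr: "p = unit_vec (Some (hub i))" "q = unit_vec (Some (wing i a))"
      "r = unit_vec (Some (wing i a'))"
    let ?Su = "top_set u" and ?Sw = "top_set w" and ?Si = "top_set i"
    let ?Tu = "swap_set i a u" and ?Tw = "swap_set i a' w"
    have ui: "u \<noteq> i" "u \<in> I" "w \<noteq> i" "w \<in> I" "i \<in> I" using fu fw i D_subset by (auto simp: far_def)
    have a: "a \<in> {1, 2}" "a' \<in> {1, 2}" "a \<noteq> a'" "a \<noteq> 0" "a' \<noteq> 0" using aa by auto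
    note mem = hub_in_top_set[OF i] wing_in_top_set[OF a(1)] wing_in_top_set[OF a(2)]
    have hubs_mem: "hub i \<in> hubs G" "wing i a \<notin> hubs G" "wing i a' \<notin> hubs G"
      using i a by (auto simp: hubs_eq)
    have M: "?Su \<in> max_stable" "?Sw \<in> max_stable" "?Si \<in> max_stable" "?Tu \<in> max_stable" "?Tw \<in> max_stable"
      using ui top_set_max_stable swap_set_max_stable[OF i a(1) fu] swap_set_max_stable[OF i a(2) fw] by auto
    have st: "stable_set G ?Su" "stable_set G ?Sw" "stable_set G ?Si" using M by (auto simp: max_stable_def)
    \<comment> \<open>All columns below are rewritten with \<open>f\<^sub>u = [Su] - b\<close>, \<open>r - f\<^sub>u = [Si] - [Tu]\<close>, \<open>p - q = [Su] - [Tu]\<close>,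
      \<open>- f\<^sub>u = [Da] - [Tu]\<close>, \<open>- r = [Sw'] - [Tw]\<close> and \<open>q - p = [Si] - [Tw] + [Sw'] - b\<close>.\<close>
    let ?Sw' = "?Sw - {hub i}"
    let ?Da = "insert (wing i a) (hubs G - {hub i})" and ?Da' = "insert (wing i a') (hubs G - {hub i})"
    have Si: "?Si = insert (wing i a) (insert (wing i a') (hubs G - {hub i}))"
      using i aa by (auto simp: top_set_def)
    have st': "stable_set G ?Sw'" "stable_set G ?Da" "stable_set G ?Da'"
      by (rule stable_set_subset[OF st(2)], blast)
         (rule stable_set_subset[OF st(3)], (unfold Si, blast))+
    have V: "char_vec ?Tu = char_vec ?Su - p + q" "char_vec ?Tw = char_vec ?Sw - p + r"
      "char_vec ?Si = ?b - p + q + r" "char_vec ?Sw' = char_vec ?Sw - p"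
      "char_vec ?Da = ?b - p + q" "char_vec ?Da' = ?b - p + r"
    proof -
      have S: "wing i a \<notin> ?Su - {hub i}" "wing i a' \<notin> ?Sw - {hub i}" "hub i \<in> ?Su" "hub i \<in> ?Sw"
        using mem ui by auto
      show "char_vec ?Tu = char_vec ?Su - p + q" "char_vec ?Tw = char_vec ?Sw - p + r"
        "char_vec ?Sw' = char_vec ?Sw - p"
        unfolding swap_set_def pqr char_vec_insert[OF S(1)] char_vec_insert[OF S(2)]
          char_vec_remove[OF S(3)] char_vec_remove[OF S(4)] by (rule refl)+
      have S': "wing i a \<notin> insert (wing i a') (hubs G - {hub i})" "wing i a' \<notin> hubs G - {hub i}"
        "wing i a \<notin> hubs G - {hub i}"
        using hubs_mem a by auto
      show "char_vec ?Da = ?b - p + q" "char_vec ?Da' = ?b - p + r" "char_vec ?Si = ?b - p + q + r"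
        unfolding Si pqr char_vec_insert[OF S'(1)] char_vec_insert[OF S'(2)] char_vec_insert[OF S'(3)]
          char_vec_remove[OF hubs_mem(1)] by (simp_all only: ac_simps)
    qed
    have E: "ext_col i a u a' w s = p s *\<^sub>R ((char_vec ?Su - ?b) + (char_vec ?Sw - ?b)) +
       q s *\<^sub>R (r - (char_vec ?Su - ?b)) + r s *\<^sub>R (q - (char_vec ?Sw - ?b)) +
       (char_vec ?Su s - ?b s) *\<^sub>R (p - q) + (char_vec ?Sw s - ?b s) *\<^sub>R (p - r)" for s
      unfolding ext_col_def pqr ..
    consider "v = hub i" | "v = wing i a" | "v \<in> part u" "v \<notin> hubs G" | "v = hub u" "u \<in> D"
      using v by (auto simp: part_def hubs_eq split: if_splits)
    then show ?thesis
    proof cases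
      case 1
      have ev: "p (Some v) = 1" "q (Some v) = 0" "r (Some v) = 0" "?b (Some v) = 1"
        "char_vec ?Su (Some v) = 1" "char_vec ?Sw (Some v) = 1"
        using 1 a hubs_mem mem ui by (auto simp: pqr)
      have "(sum_over (\<lambda>S. v \<in> S) - (3 * \<eta>) *\<^sub>R ?b) + \<eta> *\<^sub>R char_vec ?Su + \<eta> *\<^sub>R char_vec ?Sw \<in> ?K" (is "?c \<in> _")
        using good_hub[OF i] 1 \<eta> st by (intro plus_K good_le) auto
      moreover have "col i a u a' w v = ?c"
        unfolding col_def E ev by (intro ext) (simp add: algebra_simps)
      moreover have "(sum_over (\<lambda>S. v \<notin> S) - \<eta> *\<^sub>R char_vec ?Tu - \<eta> *\<^sub>R char_vec ?Tw)
          + \<eta> *\<^sub>R char_vec ?Da + \<eta> *\<^sub>R char_vec ?Da' \<in> ?K" (is "?d \<in> _")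
        using \<eta> st' M 1 a by (intro plus_K remove2) (auto simp: swap_set_def)
      moreover have "cocol i a u a' w v = ?d"
        unfolding cocol_def E ev V by (intro ext) (simp add: algebra_simps)
      ultimately show ?thesis by (simp only:)
    next
      case 2
      have ev: "p (Some v) = 0" "q (Some v) = 1" "r (Some v) = 0" "?b (Some v) = 0"
        "char_vec ?Su (Some v) = 0" "char_vec ?Sw (Some v) = 0"
        using 2 a hubs_mem mem ui by (auto simp: pqr)
      have "(sum_over (\<lambda>S. v \<in> S) - \<eta> *\<^sub>R char_vec ?Tu) + \<eta> *\<^sub>R char_vec ?Si \<in> ?K" (is "?c \<in> _")
        using \<eta> st M 2 by (intro plus_K remove) (auto simp: swap_set_def)
      moreover have "col i a u a' w v = ?c"
        unfolding col_def E ev V by (intro ext) (simp add: algebra_simps)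
      moreover have "(sum_over (\<lambda>S. v \<notin> S) - (2 * \<eta>) *\<^sub>R ?b - \<eta> *\<^sub>R char_vec ?Tw)
          + \<eta> *\<^sub>R char_vec ?Su + \<eta> *\<^sub>R char_vec ?Sw' \<in> ?K" (is "?d \<in> _")
      proof (intro plus_K good_remove)
        show "good (\<lambda>S. v \<notin> S)" using 2 i a hubs_mem ui by (intro good_notin[of _ i]) (auto simp: part_def)
        show "v \<notin> ?Tw" using 2 a mem ui by (auto simp: swap_set_def)
      qed (use \<eta> st st' M in auto)
      moreover have "cocol i a u a' w v = ?d"
        unfolding cocol_def E ev V by (intro ext) (simp add: algebra_simps)
      ultimately show ?thesis by (simp only:)
    next
      case 3
      have vi: "v \<noteq> hub i" "v \<noteq> wing i a" "v \<noteq> wing i a'"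
        using 3 part_neq[of u i v] ui i a by (auto simp: part_def)
      have vS: "v \<in> ?Su" "v \<notin> ?Sw" using top_set_part[OF 3] uw by auto
      have ev: "p (Some v) = 0" "q (Some v) = 0" "r (Some v) = 0" "?b (Some v) = 0"
        "char_vec ?Su (Some v) = 1" "char_vec ?Sw (Some v) = 0"
        using 3 vi vS by (auto simp: pqr)
      have "(sum_over (\<lambda>S. v \<in> S) - \<eta> *\<^sub>R char_vec ?Tu) + \<eta> *\<^sub>R char_vec ?Su \<in> ?K" (is "?c \<in> _")
        using \<eta> st M vS vi by (intro plus_K remove) (auto simp: swap_set_def)
      moreover have "col i a u a' w v = ?c"
        unfolding col_def E ev V by (intro ext) (simp add: algebra_simps)
      moreover have "(sum_over (\<lambda>S. v \<notin> S) - (2 * \<eta>) *\<^sub>R ?b - \<eta> *\<^sub>R char_vec ?Tw)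
          + \<eta> *\<^sub>R char_vec ?Si + \<eta> *\<^sub>R char_vec ?Sw' \<in> ?K" (is "?d \<in> _")
      proof (intro plus_K good_remove)
        show "good (\<lambda>S. v \<notin> S)" using good_notin[OF 3 ui(2)] .
        show "v \<notin> ?Tw" using vi vS by (auto simp: swap_set_def)
      qed (use \<eta> st st' M in auto)
      moreover have "cocol i a u a' w v = ?d"
        unfolding cocol_def E ev V by (intro ext) (simp add: algebra_simps)
      ultimately show ?thesis by (simp only:)
    next
      \<comment> \<open>Here \<open>f\<^sub>u\<close> takes the value -1 instead of 1, so the
        perturbations of column and complement are exchanged compared with the previous
        case.\<close>
      case 4
      have vi: "v \<noteq> hub i" "v \<noteq> wing i a" "v \<noteq> wing i a'" using 4 ui a by auto
      have vS: "v \<notin> ?Su" "v \<in> ?Sw" "v \<in> hubs G"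
        using 4 uw hub_in_top_set[OF 4(2)] by (auto simp: hubs_eq)
      have ev: "p (Some v) = 0" "q (Some v) = 0" "r (Some v) = 0" "?b (Some v) = 1"
        "char_vec ?Su (Some v) = 0" "char_vec ?Sw (Some v) = 1"
        using vi vS by (auto simp: pqr)
      have "(sum_over (\<lambda>S. v \<in> S) - (2 * \<eta>) *\<^sub>R ?b - \<eta> *\<^sub>R char_vec ?Tw)
          + \<eta> *\<^sub>R char_vec ?Si + \<eta> *\<^sub>R char_vec ?Sw' \<in> ?K" (is "?c \<in> _")
      proof (intro plus_K good_remove)
        show "good (\<lambda>S. v \<in> S)" using good_hub[OF 4(2)] 4(1) by simp
        show "v \<in> ?Tw" using vi vS by (auto simp: swap_set_def)
      qed (use \<eta> st st' M in auto)
      moreover have "col i a u a' w v = ?c"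
        unfolding col_def E ev V by (intro ext) (simp add: algebra_simps)
      moreover have "(sum_over (\<lambda>S. v \<notin> S) - \<eta> *\<^sub>R char_vec ?Tu) + \<eta> *\<^sub>R char_vec ?Su \<in> ?K" (is "?d \<in> _")
        using \<eta> st M vS vi by (intro plus_K remove) (auto simp: swap_set_def)
      moreover have "cocol i a u a' w v = ?d"
        unfolding cocol_def E ev V by (intro ext) (simp add: algebra_simps)
      ultimately show ?thesis by (simp only:)
    qed
  qed

  obtain i u w where i: "i \<in> D" and fu: "far i 1 u" and fw: "far i 2 w"
    using far_exists[OF cliques] by blast
  have uw: "u \<noteq> w" using far_distinct[OF i fu fw] .
  have ui: "u \<noteq> i" "u \<in> I" "w \<noteq> i" "w \<in> I" "i \<in> I" using fu fw i D_subset by (auto simp: far_def)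
  have colK: "col i 1 u 2 w v \<in> ?K \<and> cocol i 1 u 2 w v \<in> ?K" if v: "v \<in> verts G" for v
  proof -
    obtain j where j: "j \<in> I" "v \<in> part j" using v verts_parts by blast
    consider "v = hub i \<or> v = wing i 1 \<or> v \<in> part u" | "v = hub i \<or> v = wing i 2 \<or> v \<in> part w"
      | "v \<notin> part i" "v \<notin> part u" "v \<notin> part w"
      using i by (auto simp: part_def)
    then show ?thesis
    proof cases
      case 1
      then show ?thesis using cols[of i 1 2 u w v] i fu fw uw by simp
    next
      case 2
      then have "col i 2 w 1 u v \<in> ?K \<and> cocol i 2 w 1 u v \<in> ?K"
        using cols[of i 2 1 w u v] i fu fw uw by simp
      then show ?thesis by (simp only: col_def cocol_def swap[of i 2 w 1 u])
    next
      case 3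
      have neq: "v \<noteq> hub i" "v \<noteq> wing i 1" "v \<noteq> wing i 2" using 3 i by (auto simp: part_def)
      \<comment> \<open>Away from the parts of \<open>i\<close>, \<open>u\<close> and
        \<open>w\<close> both top sets agree with the hubs, so the five-cycle vanishes. Only one of
        column and complement then has to pay for \<open>hubs_vec\<close>.\<close>
      have "v \<in> top_set u \<longleftrightarrow> v \<in> hubs G" "v \<in> top_set w \<longleftrightarrow> v \<in> hubs G"
        using 3 i ui by (auto simp: top_set_def part_def hubs_eq split: if_splits)
      then have "ext_col i 1 u 2 w (Some v) = 0"
        unfolding ext_col_def using neq by (intro ext) auto
      then have c: "col i 1 u 2 w v = sum_over (\<lambda>S. v \<in> S) - (\<eta> * ?b (Some v)) *\<^sub>R ?b"
        "cocol i 1 u 2 w v = sum_over (\<lambda>S. v \<notin> S) - (\<eta> * (1 - ?b (Some v))) *\<^sub>R ?b"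
        unfolding col_def cocol_def by (intro ext, simp)+
      show ?thesis
      proof (cases "v \<in> hubs G")
        case True
        then obtain k where "k \<in> D" "v = hub k" by (auto simp: hubs_eq)
        then show ?thesis using c True good_le[OF good_hub, of k \<eta>] sum_K \<eta> by simp
      next
        case False
        then show ?thesis using c good_le[OF good_notin[OF j(2) False j(1)], of \<eta>] sum_K \<eta> by simp
      qed
    qed
  qed

  define Y where "Y r s = (\<Sum>S\<in>max_stable. char_vec S r * char_vec S s) - \<eta> * (?b r * ?b s)
      + \<eta> * ext_col i 1 u 2 w s r" for r s
  \<comment> \<open>All factors of the five-cycle vanish at \<open>None\<close>, so column
    \<open>None\<close> is exactly \<open>v_vec\<close> with
    \<open>\<epsilon> = \<eta>\<close>.\<close>
  have ext0: "ext_col i 1 u 2 w None = 0"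
    unfolding ext_col_def by (intro ext) simp
  have Y0: "(\<lambda>r. Y r None) = v_vec (card D) G \<eta>"
    unfolding v_vec_eq Y_def ext0 by (intro ext) (simp add: sum_over_def sum_fun_apply)
  have sum_filter: "(\<Sum>S\<in>max_stable. char_vec S r * char_vec S (Some v)) = sum_over (\<lambda>S. v \<in> S) r" for r v
    unfolding sum_over_def sum_fun_apply using finite_max_stable
    by (simp add: sum.inter_filter if_distrib cong: if_cong)
  have Ycol: "(\<lambda>r. Y r (Some v)) = col i 1 u 2 w v" for v
    unfolding Y_def col_def sum_filter by (intro ext) simp
  have Ycocol: "(\<lambda>r. Y r None - Y r (Some v)) = cocol i 1 u 2 w v" for v
  proof
    fix r
    have "sum_over (\<lambda>S. True) r = sum_over (\<lambda>S. v \<in> S) r + sum_over (\<lambda>S. v \<notin> S) r"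
      using sum_over_split[of "\<lambda>S. True" "\<lambda>S. v \<in> S"] by simp
    then show "Y r None - Y r (Some v) = cocol i 1 u 2 w v r"
      using fun_cong[OF Y0, of r] fun_cong[OF Ycol, of r v] unfolding v_vec_eq col_def cocol_def
      by (simp add: algebra_simps)
  qed
  have mem: "hub i \<in> top_set u" "hub i \<in> top_set w" "hub i \<in> hubs G"
    "wing i 1 \<notin> top_set u" "wing i 2 \<notin> top_set u" "wing i 1 \<notin> top_set w" "wing i 2 \<notin> top_set w"
    "wing i 1 \<notin> hubs G" "wing i 2 \<notin> hubs G"
    using i ui by (auto simp: hub_in_top_set wing_in_top_set hubs_eq)
  have diag: "Y r None = Y r r" for r
  proof (cases r)
    case (Some v)
    \<comment> \<open>Neighbouring factors of the five-cycle have disjoint supports, so its matrix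
      has zero diagonal.\<close>
    have "ext_col i 1 u 2 w (Some v) (Some v) = 0"
      unfolding ext_col_def using mem by auto
    then show ?thesis unfolding Some Y_def ext0 by simp (intro sum.cong refl, simp)
  qed simp
  have sym: "Y r s = Y s r" for r s
    unfolding Y_def ext_col_def by (simp add: algebra_simps)
  have in_verts: "hub i \<in> verts G" "wing i 1 \<in> verts G" "wing i 2 \<in> verts G" "hubs G \<subseteq> verts G"
    "top_set u \<subseteq> verts G" "top_set w \<subseteq> verts G"
    using i hubs_subset top_set_stable[OF ui(2)] top_set_stable[OF ui(4)] by (auto simp: verts_eq stable_set_def)
  have out: "Y r s = 0" if s: "s \<notin> coords (verts G)" for r s
  proof -
    obtain v where v: "s = Some v" "v \<notin> verts G" using s by (cases s) auto
    have "char_vec S (Some v) = 0" if "S \<in> max_stable" for S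
      using that v(2) by (auto simp: max_stable_def stable_set_def)
    then have "(\<Sum>S\<in>max_stable. char_vec S r * char_vec S s) = 0" using v by (intro sum.neutral) auto
    moreover have "ext_col i 1 u 2 w s = 0"
      unfolding ext_col_def v using v(2) in_verts by (intro ext) auto
    moreover have "?b s = 0" using v in_verts by auto
    ultimately show ?thesis by (simp add: Y_def)
  qed
  let ?Su = "top_set u" and ?Sw = "top_set w" and ?Si = "top_set i"
  let ?Tu = "swap_set i 1 u" and ?Tw = "swap_set i 2 w"
  \<comment> \<open>Via \<open>dot\<close> the quadratic form becomes a sum of squares over
    \<open>max_stable\<close> plus a perturbation in \<open>hubs_vec\<close> and five further linear
    forms. Five squares suffice to absorb it; the others are dropped.\<close>
  have psd: "0 \<le> (\<Sum>r\<in>coords (verts G). \<Sum>s\<in>coords (verts G). x r * x s * Y r s)" for x :: "vertex option \<Rightarrow> real"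
  proof -
    define dot where "dot y = (\<Sum>r\<in>coords (verts G). x r * y r)" for y
    have dot_add: "dot (y + z) = dot y + dot z" and dot_diff: "dot (y - z) = dot y - dot z" for y z
      by (simp_all add: dot_def algebra_simps sum.distrib sum_subtractf)
    have bil: "(\<Sum>r\<in>coords (verts G). \<Sum>s\<in>coords (verts G). x r * x s * (y r * z s)) = dot y * dot z" for y z
      by (simp add: dot_def sum_product ac_simps)
    define p q r where pqr: "p = unit_vec (Some (hub i))" "q = unit_vec (Some (wing i 1))"
      "r = unit_vec (Some (wing i 2))"
    define fu fw where f: "fu = char_vec ?Su - ?b" "fw = char_vec ?Sw - ?b"
    have E: "x k * x l * ext_col i 1 u 2 w l k =
        x k * x l * (fu k * p l) + x k * x l * (fw k * p l) + x k * x l * (r k * q l) - x k * x l * (fu k * q l)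
        + x k * x l * (q k * r l) - x k * x l * (fw k * r l) + x k * x l * (p k * fu l) - x k * x l * (q k * fu l)
        + x k * x l * (p k * fw l) - x k * x l * (r k * fw l)" for k l
      unfolding ext_col_def f pqr by (simp add: algebra_simps)
    have Eform: "(\<Sum>k\<in>coords (verts G). \<Sum>l\<in>coords (verts G). x k * x l * ext_col i 1 u 2 w l k) =
        2 * (dot p * dot fu - dot fu * dot q + dot q * dot r - dot r * dot fw + dot fw * dot p)"
      unfolding E by (simp only: sum.distrib sum_subtractf bil) (simp add: algebra_simps)
    have "(\<Sum>k\<in>coords (verts G). \<Sum>l\<in>coords (verts G). x k * x l * (\<Sum>S\<in>max_stable. char_vec S k * char_vec S l))
        = (\<Sum>k\<in>coords (verts G). \<Sum>S\<in>max_stable. \<Sum>l\<in>coords (verts G). x k * x l * (char_vec S k * char_vec S l))"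
      by (simp add: sum_distrib_left sum.swap[of _ max_stable])
    also have "\<dots> = (\<Sum>S\<in>max_stable. \<Sum>k\<in>coords (verts G). \<Sum>l\<in>coords (verts G). x k * x l * (char_vec S k * char_vec S l))"
      by (rule sum.swap)
    also have "\<dots> = (\<Sum>S\<in>max_stable. (dot (char_vec S))\<^sup>2)" by (simp only: bil power2_eq_square)
    finally have Aform: "(\<Sum>k\<in>coords (verts G). \<Sum>l\<in>coords (verts G). x k * x l * (\<Sum>S\<in>max_stable. char_vec S k * char_vec S l))
        = (\<Sum>S\<in>max_stable. (dot (char_vec S))\<^sup>2)" .
    have "(\<Sum>k\<in>coords (verts G). \<Sum>l\<in>coords (verts G). x k * x l * Y k l) =
       (\<Sum>k\<in>coords (verts G). \<Sum>l\<in>coords (verts G). x k * x l * (\<Sum>S\<in>max_stable. char_vec S k * char_vec S l))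
       - \<eta> * (\<Sum>k\<in>coords (verts G). \<Sum>l\<in>coords (verts G). x k * x l * (?b k * ?b l))
       + \<eta> * (\<Sum>k\<in>coords (verts G). \<Sum>l\<in>coords (verts G). x k * x l * ext_col i 1 u 2 w l k)"
      unfolding Y_def sum_distrib_left[of \<eta>] sum.distrib[symmetric] sum_subtractf[symmetric]
      by (intro sum.cong refl) (simp add: algebra_simps)
    then have form: "(\<Sum>k\<in>coords (verts G). \<Sum>l\<in>coords (verts G). x k * x l * Y k l) =
        (\<Sum>S\<in>max_stable. (dot (char_vec S))\<^sup>2) - \<eta> * (dot ?b)\<^sup>2
        + 2 * \<eta> * (dot p * dot fu - dot fu * dot q + dot q * dot r - dot r * dot fw + dot fw * dot p)"
      unfolding Aform Eform bil by (simp add: power2_eq_square)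
    have T: "char_vec ?Tu = char_vec ?Su - p + q" "char_vec ?Tw = char_vec ?Sw - p + r"
      unfolding swap_set_def pqr using mem by (simp_all add: char_vec_insert char_vec_remove del: plus_fun_apply)
    have "?Si = insert (wing i 1) (insert (wing i 2) (hubs G - {hub i}))" using i by (auto simp: top_set_def)
    then have Si: "char_vec ?Si = ?b - p + r + q"
      unfolding pqr using mem by (simp add: char_vec_insert char_vec_remove del: plus_fun_apply)
    have hi: "hub i \<notin> ?Tu" "hub i \<notin> ?Tw" "hub i \<notin> ?Si"
      and wi: "wing i 1 \<in> ?Tu" "wing i 2 \<notin> ?Tu" "wing i 1 \<notin> ?Tw" "wing i 2 \<in> ?Tw" "wing i 1 \<in> ?Si" "wing i 2 \<in> ?Si"
      using mem i by (auto simp: swap_set_def hub_in_top_set wing_in_top_set)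
    \<comment> \<open>The five sets must be distinct for their squares to occur separately. The hub
      and wings of \<open>i\<close> distinguish all pairs except this one.\<close>
    have "?Su \<noteq> ?Sw"
    proof (cases "u \<in> D")
      case True
      then show ?thesis using hub_in_top_set[OF True, of u] hub_in_top_set[OF True, of w] uw by auto
    next
      case False
      then show ?thesis using orig_in_top_set[of u u] orig_in_top_set[of u w] uw by auto
    qed
    then have dist: "?Su \<noteq> ?Sw" "?Su \<noteq> ?Si" "?Su \<noteq> ?Tu" "?Su \<noteq> ?Tw" "?Sw \<noteq> ?Si" "?Sw \<noteq> ?Tu" "?Sw \<noteq> ?Tw"
      "?Si \<noteq> ?Tu" "?Si \<noteq> ?Tw" "?Tu \<noteq> ?Tw"
      using hi wi mem by metis+
    have "{?Su, ?Sw, ?Si, ?Tu, ?Tw} \<subseteq> max_stable"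
      using ui top_set_max_stable swap_set_max_stable[OF i _ fu] swap_set_max_stable[OF i _ fw] by auto
    then have "(\<Sum>S\<in>{?Su, ?Sw, ?Si, ?Tu, ?Tw}. (dot (char_vec S))\<^sup>2) \<le> (\<Sum>S\<in>max_stable. (dot (char_vec S))\<^sup>2)"
      using finite_max_stable by (intro sum_mono2) auto
    moreover have "(\<Sum>S\<in>{?Su, ?Sw, ?Si, ?Tu, ?Tw}. (dot (char_vec S))\<^sup>2) = (dot (char_vec ?Su))\<^sup>2 +
        (dot (char_vec ?Sw))\<^sup>2 + (dot (char_vec ?Si))\<^sup>2 + (dot (char_vec ?Tu))\<^sup>2 + (dot (char_vec ?Tw))\<^sup>2"
      using dist by simp
    moreover have dots: "dot (char_vec ?Su) = dot ?b + dot fu" "dot (char_vec ?Sw) = dot ?b + dot fw"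
      "dot (char_vec ?Si) = dot ?b - dot p + dot q + dot r"
      "dot (char_vec ?Tu) = dot ?b + dot fu - dot p + dot q"
      "dot (char_vec ?Tw) = dot ?b + dot fw - dot p + dot r"
      unfolding T Si f dot_add dot_diff by simp_all
    ultimately have "(dot ?b + dot fu)\<^sup>2 + (dot ?b + dot fw)\<^sup>2 + (dot ?b - dot p + dot q + dot r)\<^sup>2 +
        (dot ?b + dot fu - dot p + dot q)\<^sup>2 + (dot ?b + dot fw - dot p + dot r)\<^sup>2
        \<le> (\<Sum>S\<in>max_stable. (dot (char_vec S))\<^sup>2)"
      by (simp only: dots)
    then show ?thesis
      using five_squares_perturbed_nonneg[of \<eta> "dot ?b" "dot fu" "dot fw" "dot p" "dot q" "dot r"] \<eta>
      unfolding form by linarith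
  qed
  have "Y \<in> sym_psd (coords (verts G))"
    unfolding sym_psd_iff using out sym psd by metis
  moreover have "Y None None > 0"
  proof -
    have "card max_stable > 0"
      using top_set_max_stable[OF ui(5)] finite_max_stable by (auto simp: card_gt_0_iff)
    then have "real (card max_stable) \<ge> 1" by simp
    moreover have "Y None None = real (card max_stable) - \<eta>" unfolding Y_def ext0 by simp
    ultimately show ?thesis using \<eta> by linarith
  qed
  ultimately have "(\<lambda>r. Y r None) \<in> lift_cone (LS_plus (verts G) P)"
    using colK by (intro lift_cone_LS_plusI finite_verts diag) (auto simp: Ycol Ycocol)
  then show ?thesis unfolding Y0 using \<eta> by blast
qed

end

section \<open>Induction on the number of rounds\<close>

text \<open>Deleting an index lowers \<open>m\<close> and the size of \<open>I\<close> together, so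
  both bounds persist. The guard \<open>0 < m\<close> suits the application, where the truncated
  difference \<open>n - k\<close> may be 0.\<close>

theorem stretched_v_vec_in_LS_plus:
  assumes "stretched_clique_exact I D G" "m + 3 \<le> card I"
    and "\<And>C. 0 < m \<Longrightarrow> clique G C \<Longrightarrow> card C + m \<le> card I"
  shows "\<exists>\<epsilon>>0. v_vec (card D) G \<epsilon> \<in> lift_cone (LS_plus_graph m G)"
  using assms
proof (induction m arbitrary: I D G)
  case 0
  then interpret stretched_clique_exact I D G by blast
  have "v_vec (card D) G (1 / 2) \<in> lift_cone (LS_plus_graph 0 G)" using v_vec_FRAC 0 by simp
  then show ?case by (intro exI[of _ "1 / 2"]) simp
next
  case (Suc m)
  interpret stretched_clique_exact I D G by (rule Suc.prems(1))
  let ?H = "\<lambda>j. induced G (verts G - part j)"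
  have card: "card (I - {j}) = card I - 1" if "j \<in> I" for j using that finite_I by simp
  have "\<exists>\<epsilon>>0. v_vec (card (D - {j})) (?H j) \<epsilon> \<in> lift_cone (LS_plus_graph m (?H j))" if j: "j \<in> I" for j
  proof (rule Suc.IH[OF stretched_clique_delete[OF j]])
    show "m + 3 \<le> card (I - {j})" using Suc.prems(2) card[OF j] by simp
    fix C assume "clique (?H j) C"
    then have "card C + Suc m \<le> card I" using Suc.prems(3) clique_induced by blast
    then show "card C + m \<le> card (I - {j})" using card[OF j] by simp
  qed
  then obtain \<epsilon> where \<epsilon>: "\<And>j. j \<in> I \<Longrightarrow> 0 < \<epsilon> j"
      "\<And>j. j \<in> I \<Longrightarrow> v_vec (card (D - {j})) (?H j) (\<epsilon> j) \<in> lift_cone (LS_plus_graph m (?H j))"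
    by metis
  \<comment> \<open>A common value for all deletions, capped by 1 as \<open>LS_plus_step\<close>
    requires. Lowering an individual \<open>\<epsilon> j\<close> to it adds a multiple of
    \<open>hubs_vec\<close>, which lies in the cone.\<close>
  define \<epsilon>0 where "\<epsilon>0 = Min (insert 1 (\<epsilon> ` I))"
  have \<epsilon>0: "0 < \<epsilon>0" "\<epsilon>0 \<le> 1" "\<And>j. j \<in> I \<Longrightarrow> \<epsilon>0 \<le> \<epsilon> j"
    using \<epsilon>(1) finite_I by (auto simp: \<epsilon>0_def)
  have P: "convex (LS_plus_graph m G)" using finite_verts by (rule convex_LS_plus_graph)
  have stable: "indicat_real S \<in> LS_plus_graph m G" if "stable_set G S" for S
    using stable_indicator_in_LS_plus_graph[OF finite_verts that] .
  have relax: "x - \<epsilon>0 *\<^sub>R hubs_vec \<in> lift_cone (LS_plus_graph m G)"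
    if j: "j \<in> I" and x: "x - \<epsilon> j *\<^sub>R hubs_vec \<in> lift_cone (LS_plus_graph m G)" for x j
  proof -
    have "hubs_vec \<in> lift_cone (LS_plus_graph m G)" using stable[OF stable_hubs] by (simp add: char_vec_def)
    then have "(x - \<epsilon> j *\<^sub>R hubs_vec) + (\<epsilon> j - \<epsilon>0) *\<^sub>R hubs_vec \<in> lift_cone (LS_plus_graph m G)"
      using x \<epsilon>0(3)[OF j] by (intro lift_cone_add P lift_cone_scaleR) auto
    also have "(x - \<epsilon> j *\<^sub>R hubs_vec) + (\<epsilon> j - \<epsilon>0) *\<^sub>R hubs_vec = x - \<epsilon>0 *\<^sub>R hubs_vec"
      by (simp only: scaleR_diff_left) simp
    finally show ?thesis .
  qed
  have I: "I \<noteq> {j}" for j using Suc.prems(2) by auto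
  have "\<exists>\<epsilon>>0. v_vec (card D) G \<epsilon> \<in> lift_cone (LS_plus (verts G) (LS_plus_graph m G))"
  proof (rule LS_plus_step[OF P stable \<epsilon>0(1,2)])
    fix j assume j: "j \<in> D"
    then have "j \<in> I" using D_subset by blast
    then show "sum_over (\<lambda>S. hub j \<in> S) - \<epsilon>0 *\<^sub>R hubs_vec \<in> lift_cone (LS_plus_graph m G)"
      using v_vec_delete_stretched[OF j I \<epsilon>(2)] relax by blast
  next
    fix j assume j: "j \<in> I - D"
    then show "sum_over (\<lambda>S. Orig j \<notin> S) - \<epsilon>0 *\<^sub>R hubs_vec \<in> lift_cone (LS_plus_graph m G)"
      using v_vec_delete_unstretched[OF j I \<epsilon>(2)] relax by blast
  next
    fix C assume "clique G C"
    then show "card C < card I" using Suc.prems(3)[of C] by simp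
  qed
  then show ?case by simp
qed

section \<open>The rank bound\<close>

context stretched_clique_exact
begin

lemma STAB_sum_le:
  assumes "x \<in> STAB G"
  shows "(\<Sum>v\<in>verts G. x v) \<le> card D + 1"
proof -
  have "convex {x :: vertex \<Rightarrow> real. (\<Sum>v\<in>verts G. x v) \<le> card D + 1}"
  proof (rule convexI)
    fix x y :: "vertex \<Rightarrow> real" and a b :: real
    assume "x \<in> {x. (\<Sum>v\<in>verts G. x v) \<le> card D + 1}" "y \<in> {x. (\<Sum>v\<in>verts G. x v) \<le> card D + 1}"
      and ab: "0 \<le> a" "0 \<le> b" "a + b = 1"
    then have "a * (\<Sum>v\<in>verts G. x v) + b * (\<Sum>v\<in>verts G. y v) \<le> card D + 1"
      using convex_bound_le[of "\<Sum>v\<in>verts G. x v" "card D + 1" "\<Sum>v\<in>verts G. y v" a b] by simp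
    then show "a *\<^sub>R x + b *\<^sub>R y \<in> {x. (\<Sum>v\<in>verts G. x v) \<le> card D + 1}"
      by (simp add: sum.distrib sum_distrib_left)
  qed
  moreover have "FRAC G \<inter> fun_power (verts G) {0, 1} \<subseteq> {x. (\<Sum>v\<in>verts G. x v) \<le> card D + 1}"
  proof
    fix x assume "x \<in> FRAC G \<inter> fun_power (verts G) {0, 1}"
    then obtain S where S: "stable_set G S" "x = indicat_real S" using FRAC_zero_one_stable by blast
    have "(\<Sum>v\<in>verts G. x v) = card (verts G \<inter> S)"
      using finite_verts by (simp add: S indicator_def sum.If_cases)
    also have "verts G \<inter> S = S" using S by (auto simp: stable_set_def)
    finally show "x \<in> {x. (\<Sum>v\<in>verts G. x v) \<le> card D + 1}" using card_stable_le[OF S(1)] by simp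
  qed
  ultimately have "STAB G \<subseteq> {x. (\<Sum>v\<in>verts G. x v) \<le> card D + 1}"
    unfolding STAB_def integer_hull_def by (intro hull_minimal)
  then show ?thesis using assms by blast
qed

text \<open>With \<open>N\<close> maximum stable sets and \<open>d = card D\<close>, the vertex
  coordinates sum to \<open>N * (d + 1) - \<epsilon> * d\<close>, whereas the corner entry
  \<open>N - \<epsilon>\<close> allows only \<open>(N - \<epsilon>) * (d + 1)\<close>, which is
  smaller by \<open>\<epsilon>\<close>.\<close>

lemma v_vec_notin_STAB:
  assumes "0 < \<epsilon>"
  shows "v_vec (card D) G \<epsilon> \<notin> lift_cone (STAB G)"
proof
  assume "v_vec (card D) G \<epsilon> \<in> lift_cone (STAB G)"
  then obtain c x where c: "0 \<le> c" "x \<in> STAB G" and eq: "v_vec (card D) G \<epsilon> = lift_vec c (c *\<^sub>R x)"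
    by (rule lift_coneE)
  have count: "(\<Sum>v\<in>verts G. char_vec S (Some v)) = card S" if "S \<subseteq> verts G" for S
    using that finite_verts by (simp add: sum.If_cases Int_absorb1)
  have "(\<Sum>v\<in>verts G. sum_over (\<lambda>S. True) (Some v)) = (\<Sum>S\<in>max_stable. \<Sum>v\<in>verts G. char_vec S (Some v))"
    unfolding sum_over_def sum_fun_apply by (subst sum.swap) simp
  also have "\<dots> = (\<Sum>S\<in>max_stable. real (card D + 1))"
    by (intro sum.cong refl) (subst count, auto simp: max_stable_def stable_set_def)
  finally have tot: "(\<Sum>v\<in>verts G. sum_over (\<lambda>S. True) (Some v)) = card max_stable * real (card D + 1)" by simp
  have "(\<Sum>v\<in>verts G. v_vec (card D) G \<epsilon> (Some v)) =
      (\<Sum>v\<in>verts G. sum_over (\<lambda>S. True) (Some v)) - \<epsilon> * (\<Sum>v\<in>verts G. hubs_vec (Some v))"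
    unfolding v_vec_eq by (simp only: sum_distrib_left sum_subtractf[symmetric]) simp
  also have "\<dots> = card max_stable * real (card D + 1) - \<epsilon> * card D"
    unfolding tot count[OF hubs_subset] card_hubs ..
  finally have "c * (\<Sum>v\<in>verts G. x v) = card max_stable * real (card D + 1) - \<epsilon> * card D"
    unfolding eq by (simp add: sum_distrib_left)
  moreover have ceq: "c = card max_stable - \<epsilon>"
    using fun_cong[OF eq, of None] by (simp add: v_vec_eq sum_over_def sum_fun_apply)
  have "c * real (card D + 1) = card max_stable * real (card D + 1) - \<epsilon> * card D - \<epsilon>"
    unfolding ceq by (simp add: algebra_simps)
  moreover have "c * (\<Sum>v\<in>verts G. x v) \<le> c * real (card D + 1)"
    using STAB_sum_le[OF c(2)] c(1) by (intro mult_left_mono) auto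
  ultimately show False using assms by linarith
qed

text \<open>The iterates decrease and the one at index \<open>LS_plus_rank G\<close> equals
  \<open>STAB G\<close>; a rank of at most \<open>m\<close> would put \<open>v_vec\<close> into the
  cone over \<open>STAB G\<close>.\<close>

lemma LS_plus_rank_greater:
  assumes "0 < \<epsilon>" "v_vec (card D) G \<epsilon> \<in> lift_cone (LS_plus_graph m G)" "I \<noteq> {}"
  shows "m < LS_plus_rank G"
proof (rule ccontr)
  have "verts G \<noteq> {}" using assms(3) by (auto simp: verts_parts part_def)
  assume "\<not> m < LS_plus_rank G"
  then have "LS_plus_graph m G \<subseteq> LS_plus_graph (LS_plus_rank G) G"
    using LS_plus_graph_antimono[OF finite_verts \<open>verts G \<noteq> {}\<close>] by simp
  also have "LS_plus_graph (LS_plus_rank G) G = STAB G"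
    unfolding LS_plus_rank_def by (rule LeastI) (rule LS_plus_graph_card_verts[OF finite_verts])
  finally show False using assms(1,2) v_vec_notin_STAB lift_cone_mono by blast
qed

lemma card_clique_le_clique_number:
  assumes "clique G C"
  shows "card C \<le> clique_number G"
proof -
  have "{C. clique G C} \<subseteq> Pow (verts G)" by (auto simp: clique_def)
  then have "finite {C. clique G C}" using finite_verts finite_subset by blast
  then show ?thesis unfolding clique_number_def using assms by (intro Max_ge) auto
qed

end

theorem theorem3p9:
  fixes n d k :: nat and G :: "vertex graph"
  assumes "n \<ge> 3"
    and "stretched_clique_hat n d G"
    and "k = max 3 (clique_number G)"
  shows "(\<exists>\<epsilon>>0. v_vec d G \<epsilon> \<in> lift_cone (LS_plus_graph (n - k) G))
       \<and> LS_plus_rank G \<ge> n - k + 1"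
proof -
  obtain D where D: "card D = d" "stretched_clique_exact {1..n} D G"
    using stretched_clique_hat_imp_exact[OF assms(2)] by blast
  interpret stretched_clique_exact "{1..n}" D G by (rule D(2))
  have "\<exists>\<epsilon>>0. v_vec (card D) G \<epsilon> \<in> lift_cone (LS_plus_graph (n - k) G)"
  proof (rule stretched_v_vec_in_LS_plus[OF D(2)])
    \<comment> \<open>For \<open>k \<le> n\<close> this is \<open>3 \<le> k\<close>; for larger
      \<open>k\<close> the difference is truncated to 0 and \<open>n \<ge> 3\<close>
      applies.\<close>
    show "n - k + 3 \<le> card {1..n}" using assms(1,3) by simp
    fix C assume "0 < n - k" "clique G C"
    then show "card C + (n - k) \<le> card {1..n}"
      using card_clique_le_clique_number[of C] assms(3) by simp
  qed
  then obtain \<epsilon> where \<epsilon>: "\<epsilon> > 0" "v_vec (card D) G \<epsilon> \<in> lift_cone (LS_plus_graph (n - k) G)" by blast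
  then have "n - k < LS_plus_rank G" using LS_plus_rank_greater[OF \<epsilon>] assms(1) by simp
  then show ?thesis using \<epsilon> D(1) by auto
qed

end
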